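(* Let $N$ be a rank two lattice and $\Sigma$ a complete smooth fan in $N_{\mathbb R}=N\otimes_{\mathbb Z}\mathbb R$. Then the lattice automorphism group $\mathrm{Aut}(N,\Sigma)$ is isomorphic to one of the groups in the set $$\{C_1, C_2, C_3, C_4, C_6, D_1, D_2, D_3, D_4, D_6\}.$$ Moreover, any group in this list is isomorphic to the lattice automorphism group of some complete two-dimensional smooth fan.
   Context: A fan $\Sigma$ in $N_{\mathbb R}$ is smooth if each of its cones is generated by elements of $N$ that form part of a $\mathbb Z$-basis of $N$; it is complete if the union of its cones is $N_{\mathbb R}$. The group $\mathrm{Aut}(N,\Sigma)$ of lattice automorphisms of $\Sigma$ is the subgroup of $\mathrm{GL}_{\mathbb Z}(N)$ of elements $g$ whose $\mathbb R$-linear extension to $N_{\mathbb R}$ sends $\Sigma$ bijectively to $\Sigma$. $C_p$ denotes the cyclic group of order $p$ and $D_p$ the dihedral group of order $2p$. Although $C_2$ and $D_1$ are abstractly isomorphic, they are distinguished by convention: $\mathrm{Aut}(N,\Sigma)$ is said to be $C_2$ if it is generated by $-\mathrm{Id}$, and $D_1$ if it is generated by a reflection of the lattice (an order two element of determinant $-1$); both cases are claimed to occur. *)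

theory Defs
  imports
    "HOL-Analysis.Analysis"
    "HOL-Algebra.Bij"
    "HOL-Algebra.Elementary_Groups"
    "HOL-Algebra.Generated_Groups"
    "HOL-Algebra.Multiplicative_Group"
begin

text \<open>
  A lattice \<^term>\<open>N\<close> is represented together with its realification: \<^term>\<open>N\<close> is a subset of a
  real vector space, the whole type, which plays the role of the tensor product of \<^term>\<open>N\<close>
  with the reals.  A finitely generated free abelian group always embeds into that tensor product,
  so nothing is lost.
\<close>

definition Z_span :: "'v::real_vector set \<Rightarrow> 'v set" where
  "Z_span B = range (\<lambda>c::'v \<Rightarrow> int. \<Sum>b\<in>B. of_int (c b) *\<^sub>R b)"

definition Z_basis :: "'v::real_vector set \<Rightarrow> 'v set \<Rightarrow> bool" where
  "Z_basis B N \<longleftrightarrow> finite B \<and> Z_span B = N \<and>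
     (\<forall>c::'v \<Rightarrow> int. (\<Sum>b\<in>B. of_int (c b) *\<^sub>R b) = 0 \<longrightarrow> (\<forall>b\<in>B. c b = 0))"

text \<open>
  The conditions \<^term>\<open>independent B\<close> and \<^term>\<open>span B = UNIV\<close> say that the canonical linear map
  from the tensor product of \<^term>\<open>N\<close> with the reals to the ambient space is an isomorphism.
\<close>

definition full_lattice :: "nat \<Rightarrow> 'v::real_vector set \<Rightarrow> bool" where
  "full_lattice r N \<longleftrightarrow>
     (\<exists>B. card B = r \<and> Z_basis B N \<and> independent B \<and> span B = UNIV)"

definition rational_polyhedral_cone :: "'v::real_vector set \<Rightarrow> 'v set \<Rightarrow> bool" where
  "rational_polyhedral_cone N \<sigma> \<longleftrightarrow>
     (\<exists>S. finite S \<and> S \<subseteq> N \<and> \<sigma> = convex_cone hull S)"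

definition strongly_convex :: "'v::real_vector set \<Rightarrow> bool" where
  "strongly_convex \<sigma> \<longleftrightarrow> \<sigma> \<inter> uminus ` \<sigma> = {0}"

text \<open>
  A face is cut out by a supporting linear functional.  Unlike \<^const>\<open>face_of\<close>, this does not
  count the empty set as a face.
\<close>

definition cone_face :: "'v::real_vector set \<Rightarrow> 'v set \<Rightarrow> bool" where
  "cone_face \<tau> \<sigma> \<longleftrightarrow>
     (\<exists>m::'v \<Rightarrow> real. linear m \<and> (\<forall>x\<in>\<sigma>. 0 \<le> m x) \<and> \<tau> = {x\<in>\<sigma>. m x = 0})"

definition fan :: "'v::real_vector set \<Rightarrow> 'v set set \<Rightarrow> bool" where
  "fan N \<Sigma> \<longleftrightarrow> finite \<Sigma> \<and>
     (\<forall>\<sigma>\<in>\<Sigma>. rational_polyhedral_cone N \<sigma> \<and> strongly_convex \<sigma>) \<and>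
     (\<forall>\<sigma>\<in>\<Sigma>. \<forall>\<tau>. cone_face \<tau> \<sigma> \<longrightarrow> \<tau> \<in> \<Sigma>) \<and>
     (\<forall>\<sigma>\<in>\<Sigma>. \<forall>\<sigma>'\<in>\<Sigma>. cone_face (\<sigma> \<inter> \<sigma>') \<sigma> \<and> cone_face (\<sigma> \<inter> \<sigma>') \<sigma>')"

definition smooth_fan :: "'v::real_vector set \<Rightarrow> 'v set set \<Rightarrow> bool" where
  "smooth_fan N \<Sigma> \<longleftrightarrow> fan N \<Sigma> \<and>
     (\<forall>\<sigma>\<in>\<Sigma>. \<exists>S B. Z_basis B N \<and> S \<subseteq> B \<and> \<sigma> = convex_cone hull S)"

definition complete_fan :: "'v::real_vector set \<Rightarrow> 'v set set \<Rightarrow> bool" where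
  "complete_fan N \<Sigma> \<longleftrightarrow> fan N \<Sigma> \<and> \<Union>\<Sigma> = UNIV"

definition additive_group :: "'v::real_vector set \<Rightarrow> 'v monoid" where
  "additive_group N = \<lparr>carrier = N, monoid.mult = (+), one = 0\<rparr>"

definition GL_Z :: "'v::real_vector set \<Rightarrow> ('v \<Rightarrow> 'v) monoid" where
  "GL_Z N = AutoGroup (additive_group N)"

text \<open>
  The function \<^term>\<open>f\<close> below is the linear extension of \<^term>\<open>g\<close>; it is unique because
  a full lattice spans the ambient space.
\<close>

definition fan_aut :: "'v::real_vector set \<Rightarrow> 'v set set \<Rightarrow> ('v \<Rightarrow> 'v) monoid" where
  "fan_aut N \<Sigma> = (GL_Z N)\<lparr>carrier :=
     {g \<in> carrier (GL_Z N). \<exists>f. linear f \<and> (\<forall>x\<in>N. f x = g x) \<and> bij_betw ((`) f) \<Sigma> \<Sigma>}\<rparr>"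

definition neg_Id :: "'v::real_vector set \<Rightarrow> 'v \<Rightarrow> 'v" where
  "neg_Id N = (\<lambda>x\<in>N. - x)"

text \<open>
  \<^term>\<open>A\<close> is the matrix of \<^term>\<open>g\<close> with respect to the basis \<^term>\<open>e\<close> of \<^term>\<open>N\<close>;
  the determinant does not depend on the choice of basis.
\<close>

definition lattice_reflection :: "'v::real_vector set \<Rightarrow> ('v \<Rightarrow> 'v) \<Rightarrow> bool" where
  "lattice_reflection N g \<longleftrightarrow> g \<in> carrier (GL_Z N) \<and> group.ord (GL_Z N) g = 2 \<and>
     (\<exists>(e::2 \<Rightarrow> 'v) (A::int^2^2). inj e \<and> Z_basis (range e) N \<and>
        (\<forall>j. g (e j) = (\<Sum>i\<in>UNIV. of_int (A $ i $ j) *\<^sub>R e i)) \<and> det A = -1)"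

text \<open>
  The pair \<^term>\<open>(a, s)\<close> stands for the rotation with index \<^term>\<open>a\<close>, composed with the
  standard reflection if \<^term>\<open>s\<close> holds.  The order is \<^term>\<open>2 * p\<close>, also in the degenerate
  cases of index 1 (order two) and 2 (Klein four-group).
\<close>

definition dihedral_group :: "nat \<Rightarrow> (int \<times> bool) monoid" where
  "dihedral_group p =
     \<lparr>carrier = {0..<int p} \<times> UNIV,
      monoid.mult = (\<lambda>(a, s) (b, t). ((if s then a - b else a + b) mod int p, s \<noteq> t)),
      one = (0, False)\<rparr>"

lemma group_dihedral_group:
  assumes "p > 0"
  shows "group (dihedral_group p)"
proof (rule groupI)
  fix x assume x: "x \<in> carrier (dihedral_group p)"
  obtain a s where [simp]: "x = (a, s)" by force
  have "(if s then a else (- a) mod int p, s) \<in> carrier (dihedral_group p)"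
    using assms x by (auto simp: dihedral_group_def)
  moreover have "(if s then a else (- a) mod int p, s) \<otimes>\<^bsub>dihedral_group p\<^esub> x
      = \<one>\<^bsub>dihedral_group p\<^esub>"
    by (auto simp: dihedral_group_def mod_simps)
  ultimately show "\<exists>y\<in>carrier (dihedral_group p).
      y \<otimes>\<^bsub>dihedral_group p\<^esub> x = \<one>\<^bsub>dihedral_group p\<^esub>" by blast
qed (use assms in \<open>auto simp: dihedral_group_def mod_simps algebra_simps\<close>)

lemma order_dihedral_group: "order (dihedral_group p) = 2 * p"
  by (simp add: order_def dihedral_group_def card_cartesian_product)

datatype group_type = Cyclic nat | Dihedral nat

text \<open>
  The abstractly isomorphic types \<^term>\<open>Cyclic 2\<close> and \<^term>\<open>Dihedral 1\<close> are told apart by their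
  generator.
\<close>

fun fan_aut_has_type :: "'v::real_vector set \<Rightarrow> 'v set set \<Rightarrow> group_type \<Rightarrow> bool" where
  "fan_aut_has_type N \<Sigma> (Cyclic p) \<longleftrightarrow>
     fan_aut N \<Sigma> \<cong> integer_mod_group p \<and>
     (p = 2 \<longrightarrow> carrier (fan_aut N \<Sigma>) = generate (GL_Z N) {neg_Id N})"
| "fan_aut_has_type N \<Sigma> (Dihedral p) \<longleftrightarrow>
     fan_aut N \<Sigma> \<cong> dihedral_group p \<and>
     (p = 1 \<longrightarrow> (\<exists>g. lattice_reflection N g \<and> carrier (fan_aut N \<Sigma>) = generate (GL_Z N) {g}))"

definition planar_group_types :: "group_type set" where
  "planar_group_types =
     {Cyclic 1, Cyclic 2, Cyclic 3, Cyclic 4, Cyclic 6,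
      Dihedral 1, Dihedral 2, Dihedral 3, Dihedral 4, Dihedral 6}"

end

theory Submission
  imports Defs
begin

text \<open>
  An automorphism of a smooth fan permutes the generators of its cones, which are the indecomposable
  lattice points of the cones. As these generators span the plane, the automorphism group of a
  complete smooth fan is a finite group of integral two by two matrices.

  In such a group all traces of determinant one elements are at most 2 in absolute value. If \<open>g\<close>
  is elliptic, then the trace of any commutator of \<open>g\<close> and \<open>h\<close> is at least 2, hence equal to 2, and
  the identity \<open>tr [g, h] = x\<^sup>2 + y\<^sup>2 + z\<^sup>2 - x y z - 2\<close> with \<open>x = tr g\<close>, \<open>y = tr h\<close>,
  \<open>z = tr (g h)\<close> leaves so few possibilities that the determinant one elements form a cyclic group of
  order 1, 2, 3, 4 or 6. An element of determinant -1 is an involution and inverts them.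

  Conversely, all types occur among the toric blow-ups of the fan of the product of two
  projective lines.
\<close>

subsection \<open>Finite groups of integral two by two matrices\<close>

text \<open>For the first half it is not enough that rotations commute: a generator is needed. The
  trace equation supplies it, since for a rotation \<open>x\<close> of well-chosen trace it forces
  one of \<open>y\<close>, \<open>x y\<close>, \<open>x y^-1\<close> to have trace 2 or -2, and such
  an element is determined by its trace. Determinants are tracked throughout because the convention
  separating \<open>Cyclic 2\<close> from \<open>Dihedral 1\<close> is invisible to the isomorphism
  type. For the second half the difficulty is to exclude further automorphisms, for fans with up to
  18 maximal cones. A plane fan is therefore stored as a list of edges: a maximal cone becomes the
  pair \<open>(u, w)\<close> of its primitive generators, ordered so that their determinant is 1.
  The fan axioms and completeness are derived once for all such lists from a partition of the
  punctured plane that blow-ups preserve. An automorphism is determined by the image of one edge, up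
  to reversal, so each edge leaves one candidate of either determinant, and all candidates can be
  tested by evaluation.\<close>

lemma mat2_eq_iff: "A = B \<longleftrightarrow> A$1$1 = B$1$1 \<and> A$1$2 = B$1$2 \<and> A$2$1 = B$2$1 \<and> A$2$2 = B$2$2"
  for A B :: "'a^2^2"
  by (auto simp: vec_eq_iff forall_2)

lemma mat2_mult_nth: "(A ** B)$i$j = A$i$1 * B$1$j + A$i$2 * B$2$j"
  for A B :: "'a::semiring_1^2^2"
  by (simp add: matrix_matrix_mult_def sum_2)

lemma mat2_one_nth:
  "(mat x :: 'a::zero^2^2)$1$1 = x" "(mat x :: 'a^2^2)$2$2 = x"
  "(mat x :: 'a^2^2)$1$2 = 0" "(mat x :: 'a^2^2)$2$1 = 0"
  by (simp_all add: mat_def)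

lemma trace_2: "trace A = A$1$1 + A$2$2" for A :: "'a::comm_ring_1^2^2"
  by (simp add: trace_def sum_2)

lemmas mat2 = mat2_eq_iff mat2_mult_nth mat2_one_nth trace_2 det_2

lemma trace_square_2: "trace (A ** A) = (trace A)\<^sup>2 - 2 * det A" for A :: "'a::comm_ring_1^2^2"
  by (simp add: mat2 power2_eq_square algebra_simps)

text \<open>For determinant 1 a right inverse is the adjugate. The entrywise form turns traces of
  products with inverses into polynomials in the original entries.\<close>

lemma right_inverse_2:
  fixes A B :: "'a::comm_ring_1^2^2"
  assumes "det A = 1" "A ** B = mat 1"
  shows "B$1$1 = A$2$2" "B$1$2 = - A$1$2" "B$2$1 = - A$2$1" "B$2$2 = A$1$1"
proof -
  obtain a b c d where A: "A$1$1 = a" "A$1$2 = b" "A$2$1 = c" "A$2$2 = d" by blast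
  obtain p q r s where B: "B$1$1 = p" "B$1$2 = q" "B$2$1 = r" "B$2$2 = s" by blast
  have e: "a * d - b * c = 1" "a * p + b * r = 1" "a * q + b * s = 0" "c * p + d * r = 0" "c * q + d * s = 1"
    using assms by (auto simp: mat2 A B)
  have "p = d * (a * p + b * r) - b * (c * p + d * r) - (a * d - b * c - 1) * p"
    "q = d * (a * q + b * s) - b * (c * q + d * s) - (a * d - b * c - 1) * q"
    "r = a * (c * p + d * r) - c * (a * p + b * r) - (a * d - b * c - 1) * r"
    "s = a * (c * q + d * s) - c * (a * q + b * s) - (a * d - b * c - 1) * s"
    by (simp_all add: algebra_simps)
  then show "B$1$1 = A$2$2" "B$1$2 = - A$1$2" "B$2$1 = - A$2$1" "B$2$2 = A$1$1"
    unfolding A B e by simp_all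
qed

text \<open>Cayley-Hamilton: for determinant 1, \<open>B'\<close> is \<open>trace B\<close> times
  the identity minus \<open>B\<close>.\<close>

lemma trace_mult_inverse:
  fixes A B B' :: "'a::comm_ring_1^2^2"
  assumes "det B = 1" "B ** B' = mat 1"
  shows "trace (A ** B') = trace A * trace B - trace (A ** B)"
  by (simp add: mat2_mult_nth trace_2 right_inverse_2[OF assms] algebra_simps)

text \<open>Fricke's trace identity.\<close>

lemma trace_commutator:
  fixes A A' B B' :: "'a::comm_ring_1^2^2"
  assumes "det A = 1" "A ** A' = mat 1" "det B = 1" "B ** B' = mat 1"
  shows "trace (A ** B ** A' ** B')
    = (trace A)\<^sup>2 + (trace B)\<^sup>2 + (trace (A ** B))\<^sup>2 - trace A * trace B * trace (A ** B) - 2"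
proof -
  obtain a b c d where A: "A$1$1 = a" "A$1$2 = b" "A$2$1 = c" "A$2$2 = d" by blast
  obtain p q r s where B: "B$1$1 = p" "B$1$2 = q" "B$2$1 = r" "B$2$2 = s" by blast
  have e: "a * d - b * c = 1" "p * s - q * r = 1"
    using assms by (auto simp: mat2 A B)
  \<comment> \<open>Homogenised by determinant factors, this holds for arbitrary matrices with
    adjugates in place of inverses, so plain expansion proves it; \<open>e\<close> then sets the
    factors to 1.\<close>
  have "trace (A ** B ** A' ** B') = (a + d)\<^sup>2 * (p * s - q * r) + (p + s)\<^sup>2 * (a * d - b * c)
      + (a * p + b * r + (c * q + d * s))\<^sup>2
      - (a + d) * (p + s) * (a * p + b * r + (c * q + d * s)) - 2 * (a * d - b * c) * (p * s - q * r)"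
    unfolding mat2_mult_nth trace_2 right_inverse_2[OF assms(1,2)] right_inverse_2[OF assms(3,4)] A B
    by (simp add: power2_eq_square algebra_simps)
  then show ?thesis
    unfolding mat2_mult_nth trace_2 A B e by simp
qed

text \<open>
  The traceless part of an elliptic matrix is a negative vector for the Killing form, which has
  signature (2,1), so this is a reverse Cauchy-Schwarz inequality.
\<close>
lemma elliptic_trace_ineq:
  fixes A B :: "int^2^2"
  assumes "det A = 1" "det B = 1" "\<bar>trace A\<bar> < 2"
  shows "4 \<le> (trace A)\<^sup>2 + (trace B)\<^sup>2 + (trace (A ** B))\<^sup>2 - trace A * trace B * trace (A ** B)"
proof -
  obtain a b c d where A: "A$1$1 = a" "A$1$2 = b" "A$2$1 = c" "A$2$2 = d" by blast
  obtain p q r s where B: "B$1$1 = p" "B$1$2 = q" "B$2$1 = r" "B$2$2 = s" by blast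
  have e: "a * d - b * c = 1" "p * s - q * r = 1" "\<bar>a + d\<bar> < 2"
    using assms by (auto simp: mat2 A B)
  \<comment> \<open>The matrix \<open>A ** B - B ** A\<close> has rows \<open>(X, Y)\<close> and
    \<open>(Z, - X)\<close>, so the goal \<open>0 \<le> X\<^sup>2 + Y * Z\<close> says that its
    determinant is not positive.\<close>
  define P X Y Z where "P = a - d" and "X = b * r - c * q"
    and "Y = P * q - b * (p - s)" and "Z = c * (p - s) - r * P"
  have "(a + d)\<^sup>2 < 2\<^sup>2" using e(3) by (intro power2_strict_mono) simp
  \<comment> \<open>The discriminant of the characteristic polynomial of \<open>A\<close> is
    negative.\<close>
  then have bc: "4 * (b * c) < - P\<^sup>2" using e(1) unfolding P_def by (simp add: power2_eq_square algebra_simps)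
  \<comment> \<open>The trace of \<open>A ** (A ** B - B ** A)\<close> vanishes.\<close>
  have orth: "P * X + b * Z + c * Y = 0" unfolding X_def Y_def Z_def by (simp add: algebra_simps)
  have "0 \<le> X\<^sup>2 + Y * Z"
  proof (cases "0 \<le> Y * Z")
    case False
    have PX: "P * X = - (b * Z + c * Y)" using orth by linarith
    have "(P * X)\<^sup>2 = (b * Z - c * Y)\<^sup>2 + 4 * (b * c) * (Y * Z)"
      unfolding PX by (simp add: power2_eq_square algebra_simps)
    then have "4 * (b * c) * (Y * Z) \<le> (P * X)\<^sup>2" by simp
    moreover have "- P\<^sup>2 * (Y * Z) < 4 * (b * c) * (Y * Z)" using bc False by (intro mult_strict_right_mono_neg) auto
    ultimately have "0 < P\<^sup>2 * (X\<^sup>2 + Y * Z)" by (simp add: power_mult_distrib algebra_simps)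
    then show ?thesis by (simp add: zero_less_mult_iff)
  qed simp
  moreover have "(a + d)\<^sup>2 * (p * s - q * r) + (p + s)\<^sup>2 * (a * d - b * c)
      + (a * p + b * r + (c * q + d * s))\<^sup>2
      - (a + d) * (p + s) * (a * p + b * r + (c * q + d * s))
      - 4 * (a * d - b * c) * (p * s - q * r) = X\<^sup>2 + Y * Z"
    unfolding X_def Y_def Z_def P_def by (simp add: power2_eq_square algebra_simps)
  ultimately show ?thesis unfolding mat2_mult_nth trace_2 A B e by linarith
qed

text \<open>A finite group with a faithful integral representation. The group stays abstract so that
  the results apply directly to \<open>fan_aut\<close>, whose elements are maps on the lattice and
  not matrices.\<close>

locale finite_planar_group = group G for G (structure) +
  fixes \<phi> :: "'a \<Rightarrow> int^2^2"
  assumes finite_carrier: "finite (carrier G)"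
    and rep_one: "\<phi> \<one> = mat 1"
    and rep_mult: "\<lbrakk>x \<in> carrier G; y \<in> carrier G\<rbrakk> \<Longrightarrow> \<phi> (x \<otimes> y) = \<phi> x ** \<phi> y"
    and rep_inj: "inj_on \<phi> (carrier G)"
begin

definition rotations :: "'a set" where
  "rotations = {x \<in> carrier G. det (\<phi> x) = 1}"

lemma rep_eq_iff: "\<lbrakk>x \<in> carrier G; y \<in> carrier G\<rbrakk> \<Longrightarrow> \<phi> x = \<phi> y \<longleftrightarrow> x = y"
  using rep_inj by (auto dest: inj_onD)

lemma rep_inv: "x \<in> carrier G \<Longrightarrow> \<phi> x ** \<phi> (inv x) = mat 1"
  by (metis inv_closed r_inv rep_mult rep_one)

lemma det_rep: "x \<in> carrier G \<Longrightarrow> det (\<phi> x) = 1 \<or> det (\<phi> x) = -1"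
  using arg_cong[OF rep_inv, of x det] by (auto simp: det_mul zmult_eq_1_iff)

lemma rotations_carrier: "x \<in> rotations \<Longrightarrow> x \<in> carrier G"
  by (simp add: rotations_def)

lemma rotations_det: "x \<in> rotations \<Longrightarrow> det (\<phi> x) = 1"
  by (simp add: rotations_def)

lemma rotations_mult: "\<lbrakk>x \<in> rotations; y \<in> rotations\<rbrakk> \<Longrightarrow> x \<otimes> y \<in> rotations"
  by (simp add: rotations_def rep_mult det_mul)

lemma rotations_inv: "x \<in> rotations \<Longrightarrow> inv x \<in> rotations"
  using arg_cong[OF rep_inv, of x det] by (simp add: rotations_def det_mul)

lemma finite_rotations: "finite rotations"
  using finite_carrier by (simp add: rotations_def)

text \<open>Squaring a rotation of maximal absolute trace would increase the trace if that were above 2.\<close>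
lemma rotations_trace:
  assumes "x \<in> rotations"
  shows "\<bar>trace (\<phi> x)\<bar> \<le> 2"
proof -
  let ?T = "(\<lambda>x. \<bar>trace (\<phi> x)\<bar>) ` rotations"
  have "Max ?T \<in> ?T" using assms finite_rotations by (intro Max_in) auto
  then obtain y where y: "y \<in> rotations" "\<bar>trace (\<phi> y)\<bar> = Max ?T" by auto
  have le: "\<bar>trace (\<phi> z)\<bar> \<le> \<bar>trace (\<phi> y)\<bar>" if "z \<in> rotations" for z
    unfolding y using that finite_rotations by auto
  let ?t = "\<bar>trace (\<phi> y)\<bar>"
  have "trace (\<phi> (y \<otimes> y)) = ?t\<^sup>2 - 2"
    using y(1) by (simp add: rep_mult rotations_carrier trace_square_2 rotations_det)
  with le[OF rotations_mult[OF y(1) y(1)]] have "?t\<^sup>2 - 2 \<le> ?t" by linarith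
  then have "?t \<le> 2" 
  proof (rule contrapos_pp)
    assume "\<not> ?t \<le> 2"
    then have "3 * ?t \<le> ?t * ?t" by (intro mult_right_mono) auto
    with \<open>\<not> ?t \<le> 2\<close> show "\<not> ?t\<^sup>2 - 2 \<le> ?t" unfolding power2_eq_square by linarith
  qed
  with le[OF assms] show ?thesis by linarith
qed

text \<open>A unipotent \<open>1 + M\<close> has square \<open>1 + 2 M\<close>.\<close>
lemma rotations_trace_2:
  assumes "x \<in> rotations" "trace (\<phi> x) = 2"
  shows "x = \<one>"
proof -
  let ?U = "{x \<in> rotations. trace (\<phi> x) = 2}"
  let ?m = "\<lambda>x. \<bar>\<phi> x$1$1 - 1\<bar> + \<bar>\<phi> x$1$2\<bar> + \<bar>\<phi> x$2$1\<bar>"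
  have "Max (?m ` ?U) \<in> ?m ` ?U" using assms finite_rotations by (intro Max_in) auto
  then obtain y where y: "y \<in> rotations" "trace (\<phi> y) = 2" "?m y = Max (?m ` ?U)" by auto
  have le: "?m z \<le> ?m y" if "z \<in> ?U" for z
    unfolding y using that finite_rotations by (intro Max_ge) auto
  obtain a b c d where A: "\<phi> y$1$1 = a" "\<phi> y$1$2 = b" "\<phi> y$2$1 = c" "\<phi> y$2$2 = d" by blast
  have e: "a * d - b * c = 1" "a + d = 2"
    using rotations_det[OF y(1)] y(2) by (auto simp: mat2 A)
  have "y \<otimes> y \<in> ?U" using y 
    by (simp add: rep_mult rotations_carrier trace_square_2 rotations_det rotations_mult)
  from le[OF this] have "\<bar>a * a + b * c - 1\<bar> + \<bar>a * b + b * d\<bar> + \<bar>c * a + d * c\<bar> \<le> \<bar>a - 1\<bar> + \<bar>b\<bar> + \<bar>c\<bar>"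
    using y(1) by (simp add: rep_mult rotations_carrier mat2_mult_nth A)
  moreover have d: "d = 2 - a" using e(2) by simp
  have "a * a + b * c - 1 = 2 * (a - 1)" "a * b + b * d = 2 * b" "c * a + d * c = 2 * c"
    using e(1) unfolding d by (simp_all add: algebra_simps)
  ultimately have "?m y = 0" unfolding A by simp
  with le[of x] assms have "?m x \<le> 0" by simp
  then have "\<phi> x$1$1 = 1" "\<phi> x$1$2 = 0" "\<phi> x$2$1 = 0" by linarith+
  then have "\<phi> x = mat 1" using assms(2) by (simp add: mat2)
  then show ?thesis using assms(1) by (metis one_closed rep_eq_iff rep_one rotations_carrier)
qed

text \<open>The square has trace (-2)^2 - 2 = 2 and is the identity; as the trace is not 0, the
  off-diagonal entries of such an involution vanish.\<close>

lemma rotations_trace_minus_2: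
  assumes "x \<in> rotations" "trace (\<phi> x) = -2"
  shows "\<phi> x = - mat 1"
proof -
  have "x \<otimes> x = \<one>" using assms
    by (intro rotations_trace_2)
      (simp_all add: rep_mult rotations_carrier trace_square_2 rotations_det rotations_mult)
  then have xx: "\<phi> x ** \<phi> x = mat 1" by (metis assms(1) rep_mult rep_one rotations_carrier)
  obtain a b c d where A: "\<phi> x$1$1 = a" "\<phi> x$1$2 = b" "\<phi> x$2$1 = c" "\<phi> x$2$2 = d" by blast
  have e: "a * a + b * c = 1" "a * b + b * d = 0" "c * a + d * c = 0" "a * d - b * c = 1" "a + d = -2"
    using xx assms(2) rotations_det[OF assms(1)] by (auto simp: mat2 A algebra_simps)
  have "b * (a + d) = 0" "c * (a + d) = 0" using e(2,3) by (simp_all only: distrib_left mult.commute)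
  then have "b = 0" "c = 0" using e(5) by auto
  moreover have "a * (a + d) = 2" using e(1,4) by (simp add: algebra_simps)
  then have "a = -1" "d = -1" using e(5) by auto
  ultimately show ?thesis by (simp add: mat2 A)
qed

text \<open>For determinant -1 the square is a rotation of trace t^2 + 2, and the bound 2 on traces
  forces t = 0.\<close>

lemma reflections_involutive:
  assumes "x \<in> carrier G" "det (\<phi> x) = -1"
  shows "x \<otimes> x = \<one>"
proof -
  have xx: "x \<otimes> x \<in> rotations" using assms by (simp add: rotations_def rep_mult det_mul)
  have tr: "trace (\<phi> (x \<otimes> x)) = (trace (\<phi> x))\<^sup>2 + 2"
    using assms by (simp add: rep_mult trace_square_2)
  with rotations_trace[OF xx] have "(trace (\<phi> x))\<^sup>2 \<le> 0" by linarith
  with tr show ?thesis by (intro rotations_trace_2[OF xx]) simp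
qed

lemma rotations_trace_eq:
  assumes "x \<in> rotations" "y \<in> rotations" "\<bar>trace (\<phi> x)\<bar> < 2"
  shows "(trace (\<phi> x))\<^sup>2 + (trace (\<phi> y))\<^sup>2 + (trace (\<phi> (x \<otimes> y)))\<^sup>2
    - trace (\<phi> x) * trace (\<phi> y) * trace (\<phi> (x \<otimes> y)) = 4"
proof -
  note c = assms(1,2)[THEN rotations_carrier] and d = assms(1,2)[THEN rotations_det]
  have "x \<otimes> y \<otimes> inv x \<otimes> inv y \<in> rotations"
    using assms by (intro rotations_mult rotations_inv)
  from rotations_trace[OF this] have "trace (\<phi> (x \<otimes> y \<otimes> inv x \<otimes> inv y)) \<le> 2" by linarith
  then show ?thesis
    using elliptic_trace_ineq[OF d assms(3)] c 
    by (simp add: rep_mult trace_commutator[OF d(1) rep_inv[OF c(1)] d(2) rep_inv[OF c(2)]])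
qed

lemma rotations_trace_inv:
  assumes "x \<in> rotations" "y \<in> rotations"
  shows "trace (\<phi> (x \<otimes> inv y)) = trace (\<phi> x) * trace (\<phi> y) - trace (\<phi> (x \<otimes> y))"
  using assms by (simp add: rep_mult rotations_carrier trace_mult_inverse rotations_det rep_inv)

end

section \<open>Recognition of cyclic and dihedral groups by generators\<close>

context group
begin

lemma int_pow_mod_ord:
  assumes "x \<in> carrier G"
  shows "x [^] (k mod int (ord x)) = x [^] k"
proof -
  have "int (ord x) dvd k mod int (ord x) - k"
    by (simp add: mod_eq_dvd_iff[symmetric])
  then show ?thesis using assms by (simp add: int_pow_eq minus_mod_eq_mult_div)
qed

lemma iso_integer_mod_groupI:
  assumes r: "r \<in> carrier G" "ord r > 0" and gen: "carrier G = generate G {r}"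
  shows "G \<cong> integer_mod_group (ord r)"
proof -
  let ?n = "ord r"
  have n: "carrier (integer_mod_group ?n) = {0..<int ?n}"
    using r by (simp add: carrier_integer_mod_group)
  have "(\<lambda>k::int. r [^] k) \<in> iso (integer_mod_group ?n) G"
  proof (rule isoI)
    show "(\<lambda>k::int. r [^] k) \<in> hom (integer_mod_group ?n) G"
      using r by (intro homI) (auto simp: int_pow_mod_ord int_pow_mult)
    show "bij_betw (\<lambda>k::int. r [^] k) (carrier (integer_mod_group ?n)) (carrier G)"
      unfolding bij_betw_def
    proof (intro conjI equalityI subsetI inj_onI)
      fix a b assume "a \<in> carrier (integer_mod_group ?n)" "b \<in> carrier (integer_mod_group ?n)" "r [^] a = r [^] b"
      then show "a = b"
        using r unfolding n by (simp add: int_pow_eq mod_eq_dvd_iff[symmetric])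
    next
      fix x assume "x \<in> carrier G"
      then obtain k :: int where "x = r [^] k" unfolding gen generate_pow[OF r(1)] by blast
      then have "x = r [^] (k mod int ?n)" "k mod int ?n \<in> carrier (integer_mod_group ?n)"
        using r unfolding n by (simp_all add: int_pow_mod_ord)
      then show "x \<in> (\<lambda>k::int. r [^] k) ` carrier (integer_mod_group ?n)" by blast
    qed (use r in auto)
  qed
  then show ?thesis
    using group.iso_sym[OF group_integer_mod_group] is_isoI by blast
qed

text \<open>The isomorphism is built from the model to \<open>G\<close>: \<open>(a, b)\<close> goes
  to \<open>r [^] a\<close>, multiplied by \<open>s\<close> if \<open>b\<close> holds. It is
  multiplicative because \<open>s\<close> inverts all powers of \<open>r\<close>, and injective
  because \<open>s\<close> is not such a power.\<close>

lemma iso_dihedral_groupI: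
  assumes r: "r \<in> carrier G" "ord r > 0" and s: "s \<in> carrier G" "s \<otimes> s = \<one>"
    and sr: "s \<otimes> r \<otimes> s = inv r" and notin: "s \<notin> generate G {r}"
    and gen: "carrier G = generate G {r} \<union> (\<lambda>x. x \<otimes> s) ` generate G {r}"
  shows "G \<cong> dihedral_group (ord r)"
proof -
  let ?n = "ord r"
  have n: "carrier (dihedral_group ?n) = {0..<int ?n} \<times> UNIV"
    by (simp add: dihedral_group_def)
  define f where "f = (\<lambda>(a::int, b). r [^] a \<otimes> (if b then s else \<one>))"
  have conj: "s \<otimes> (r [^] (k::int)) = r [^] (- k) \<otimes> s" for k
  proof -
    \<comment> \<open>Conjugation by the involution \<open>s\<close> is an endomorphism, which
      carries the relation from \<open>r\<close> to its integer powers.\<close>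
    have hom: "(\<lambda>x. s \<otimes> x \<otimes> s) \<in> hom G G"
    proof (rule homI)
      fix x y assume xy: "x \<in> carrier G" "y \<in> carrier G"
      have "s \<otimes> x \<otimes> s \<otimes> (s \<otimes> y \<otimes> s) = s \<otimes> x \<otimes> (s \<otimes> s) \<otimes> y \<otimes> s"
        using xy s(1) by (simp add: m_assoc)
      then show "s \<otimes> (x \<otimes> y) \<otimes> s = s \<otimes> x \<otimes> s \<otimes> (s \<otimes> y \<otimes> s)"
        using xy s by (simp add: m_assoc)
    qed (use s in auto)
    have "s \<otimes> (r [^] k) \<otimes> s = (s \<otimes> r \<otimes> s) [^] k"
      using hom_int_pow[OF hom r(1) is_group is_group] .
    also have "\<dots> = r [^] (- k)" using r sr by (simp add: int_pow_inv int_pow_neg)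
    finally have "s \<otimes> (r [^] k) \<otimes> s \<otimes> s = r [^] (- k) \<otimes> s" by simp
    then show ?thesis using r s by (simp add: m_assoc)
  qed
  have "f \<in> iso (dihedral_group ?n) G"
  proof (rule isoI)
    show "f \<in> hom (dihedral_group ?n) G"
    proof (rule homI)
      fix x y assume "x \<in> carrier (dihedral_group ?n)" "y \<in> carrier (dihedral_group ?n)"
      obtain a i b j where xy: "x = (a, i)" "y = (b, j)" by (meson surj_pair)
      \<comment> \<open>With \<open>z\<close> being \<open>s\<close> or the identity, this and the
        next fact cover the four combinations of \<open>i\<close> and \<open>j\<close>.\<close>
      have *: "r [^] a \<otimes> s \<otimes> (r [^] b \<otimes> z) = r [^] (a - b) \<otimes> (s \<otimes> z)" if "z \<in> carrier G" for z
      proof -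
        have "r [^] a \<otimes> s \<otimes> (r [^] b \<otimes> z) = r [^] a \<otimes> (s \<otimes> r [^] b) \<otimes> z"
          using r s that by (simp add: m_assoc)
        also have "\<dots> = r [^] a \<otimes> r [^] (- b) \<otimes> (s \<otimes> z)"
          unfolding conj using r s that by (simp add: m_assoc)
        finally show ?thesis using r by (simp flip: int_pow_mult)
      qed
      have **: "r [^] a \<otimes> (r [^] b \<otimes> z) = r [^] (a + b) \<otimes> z" if "z \<in> carrier G" for z
        using r that by (simp add: int_pow_mult m_assoc)
      show "f (x \<otimes>\<^bsub>dihedral_group ?n\<^esub> y) = f x \<otimes> f y"
        using r s *[of s] *[of \<one>] **[of s] **[of \<one>]
        by (cases i; cases j)
          (simp_all add: xy f_def dihedral_group_def int_pow_mod_ord)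
    qed (use r s in \<open>auto simp: f_def\<close>)
    show "bij_betw f (carrier (dihedral_group ?n)) (carrier G)"
      unfolding bij_betw_def
    proof (intro conjI equalityI subsetI inj_onI)
      fix x y assume *: "x \<in> carrier (dihedral_group ?n)" "y \<in> carrier (dihedral_group ?n)" "f x = f y"
      obtain a i b j where xy: "x = (a, i)" "y = (b, j)" by (meson surj_pair)
      have ij: "i = j"
      proof (rule ccontr)
        assume ij: "i \<noteq> j"
        have "\<exists>(c::int) (d::int). r [^] c \<otimes> s = r [^] d"
          using *(3) r s ij by (cases i; cases j) (simp_all add: f_def xy, metis+)
        then obtain c d :: int where "r [^] c \<otimes> s = r [^] d" by blast
        then have "s = r [^] (- c) \<otimes> r [^] d"
          using r s by (metis int_pow_closed int_pow_neg inv_solve_left)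
        then have "s = r [^] (- c + d)" by (simp only: int_pow_mult[OF r(1)])
        with notin r show False by (auto simp: generate_pow)
      qed
      with *(3) r s have "r [^] a = r [^] b" by (auto simp: f_def xy split: if_splits)
      with * r have "a = b" unfolding n by (simp add: xy int_pow_eq mod_eq_dvd_iff[symmetric])
      with ij show "x = y" by (simp add: xy)
    next
      fix x assume "x \<in> carrier G"
      then consider (rot) k :: int where "x = r [^] k" | (refl) k :: int where "x = r [^] k \<otimes> s"
        unfolding gen generate_pow[OF r(1)] by blast
      then obtain k :: int and b where "x = f (k, b)"
      proof cases
        case rot
        then show ?thesis using r that[of k False] by (simp add: f_def)
      next
        case refl
        then show ?thesis using that[of k True] by (simp add: f_def)
      qed
      then have "x = f (k mod int ?n, b)" "(k mod int ?n, b) \<in> carrier (dihedral_group ?n)"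
        using r unfolding n f_def by (simp_all add: int_pow_mod_ord)
      then show "x \<in> f ` carrier (dihedral_group ?n)" by blast
    qed (use r s in \<open>auto simp: f_def\<close>)
  qed
  then show ?thesis
    using group.iso_sym[OF group_dihedral_group] r is_isoI by blast
qed

end

section \<open>The rotation subgroup is cyclic of order 1, 2, 3, 4 or 6\<close>

context finite_planar_group
begin

lemma one_rotation: "\<one> \<in> rotations"
  by (simp add: rotations_def rep_one)

lemma trace_rep_square: "x \<in> rotations \<Longrightarrow> trace (\<phi> (x \<otimes> x)) = (trace (\<phi> x))\<^sup>2 - 2"
  by (simp add: rep_mult rotations_carrier trace_square_2 rotations_det)

lemma generate_rotation_subset: "r \<in> rotations \<Longrightarrow> generate G {r} \<subseteq> rotations"
proof
  fix x assume r: "r \<in> rotations" and "x \<in> generate G {r}"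
  from this(2) show "x \<in> rotations"
    by (induction rule: generate.induct) (use r in \<open>auto intro: one_rotation rotations_mult rotations_inv\<close>)
qed

lemma rotation_eqI:
  assumes "x \<in> rotations" "y \<in> rotations" "trace (\<phi> x) = -2" "trace (\<phi> y) = -2"
  shows "x = y"
  using assms by (metis rep_eq_iff rotations_carrier rotations_trace_minus_2)

text \<open>The exponent \<open>k\<close> need not be the exact order: the order divides
  \<open>k\<close>, and every divisor of an admissible value is admissible.\<close>

lemma rotations_cyclicI:
  assumes x: "x \<in> rotations" and k: "x [^] (k::nat) = \<one>" "k \<in> {1,2,3,4,6}"
    and gen: "\<And>y. y \<in> rotations \<Longrightarrow> y \<in> generate G {x}"
  shows "\<exists>r\<in>rotations. ord r \<in> {1,2,3,4,6} \<and> rotations = generate G {r}"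
proof (intro bexI conjI)
  have d: "ord x dvd k" using k x by (simp add: pow_eq_id rotations_carrier)
  then have "ord x \<le> k" using k(2) by (intro dvd_imp_le) auto
  then have "ord x \<in> {0..6}" using k by auto
  then have "ord x \<in> {0,1,2,3,4,5,6}" by (auto simp: numeral_eq_Suc le_Suc_eq)
  then show "ord x \<in> {1,2,3,4,6}" using d k(2) by auto
qed (use gen generate_rotation_subset x in auto)

text \<open>The generator is chosen by its trace: 0, 1 and -1 belong to the orders 4, 6 and 3. The
  local facts \<open>one\<close>, \<open>inv\<close> and \<open>eq\<close> treat the situations
  where \<open>y\<close>, \<open>x y\<close> or \<open>x y^-1\<close> has trace 2 and hence is the
  identity.\<close>

lemma rotations_cyclic: "\<exists>r\<in>rotations. ord r \<in> {1,2,3,4,6} \<and> rotations = generate G {r}"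
proof -
  let ?T = "\<lambda>x. trace (\<phi> x)"
  have T: "?T y \<in> {-2,-1,0,1,2}" if "y \<in> rotations" for y
    using rotations_trace[OF that] by auto
  note c = rotations_carrier
  have inv: "y \<in> generate G {x}" if "x \<in> rotations" "y \<in> rotations" "?T (x \<otimes> y) = 2" for x y
  proof -
    have "x \<otimes> y = \<one>" using that by (intro rotations_trace_2 rotations_mult)
    then have "y = inv x" using that c by (metis inv_equality inv_inv inv_closed)
    then show ?thesis by (auto intro: generate.inv)
  qed
  have eq: "y \<in> generate G {x}" if "x \<in> rotations" "y \<in> rotations" "?T (x \<otimes> inv y) = 2" for x y
  proof -
    have "x \<otimes> inv y = \<one>" using that by (intro rotations_trace_2 rotations_mult rotations_inv)
    then have "y = x" using that c by (metis inv_equality inv_inv inv_closed)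
    then show ?thesis by (auto intro: generate.incl)
  qed
  have one: "y \<in> generate G {x}" if "y \<in> rotations" "?T y = 2" for x y
    using rotations_trace_2[OF that] by (auto intro: generate.one)
  have mult: "y \<otimes> z \<in> generate G {x}" if "y \<in> generate G {x}" "z \<in> generate G {x}" for x y z
    using that by (rule generate.eng)
  \<comment> \<open>In case (c) the traces 0 and 1 must be excluded: in a cyclic group of order 6 an
    element of trace -1 generates only the subgroup of order 3.\<close>
  consider (a) x where "x \<in> rotations" "?T x = 0" | (b) x where "x \<in> rotations" "?T x = 1"
    | (c) x where "x \<in> rotations" "?T x = -1" "\<And>y. y \<in> rotations \<Longrightarrow> ?T y \<noteq> 1" "\<And>y. y \<in> rotations \<Longrightarrow> ?T y \<noteq> 0"
    | (d) "\<And>y. y \<in> rotations \<Longrightarrow> ?T y = 2 \<or> ?T y = -2"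
    using T by fast
  then show ?thesis
  proof cases
    case a
    have x: "x \<in> generate G {x}" by (auto intro: generate.incl)
    have m: "?T (x \<otimes> x) = -2" "x \<otimes> x \<in> rotations" using a by (simp_all add: trace_rep_square rotations_mult)
    have "x \<otimes> x \<otimes> (x \<otimes> x) = \<one>"
      using m by (intro rotations_trace_2) (simp_all add: trace_rep_square rotations_mult)
    then have "x [^] (4::nat) = \<one>" using c[OF a(1)] by (simp add: numeral_eq_Suc m_assoc)
    moreover have "y \<in> generate G {x}" if y: "y \<in> rotations" for y
    proof -
      have xy: "x \<otimes> y \<in> rotations" using a y rotations_mult by blast
      have e: "(?T y)\<^sup>2 + (?T (x \<otimes> y))\<^sup>2 = 4" using rotations_trace_eq[OF a(1) y] a by simp
      consider "?T y = 2" | "?T y = -2" | "?T (x \<otimes> y) = 2" | "?T (x \<otimes> y) = -2"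
        using T[OF y] T[OF xy] e by auto
      then show ?thesis
      proof cases
        case 2 then have "y = x \<otimes> x" using m y by (intro rotation_eqI)
        then show ?thesis using x mult by blast
      next
        case 4 then have "x \<otimes> y = x \<otimes> x" using m xy by (intro rotation_eqI)
        then have "y = x" using a y c by simp
        then show ?thesis using x by blast
      qed (use one inv a y in auto)
    qed
    ultimately show ?thesis using a by (intro rotations_cyclicI[of x 4]) auto
  next
    case b
    have x: "x \<in> generate G {x}" by (auto intro: generate.incl)
    have 2: "?T (x \<otimes> x) = -1" "x \<otimes> x \<in> rotations" using b by (simp_all add: trace_rep_square rotations_mult)
    \<comment> \<open>Since the left side is the trace 1 of \<open>x\<close>, this computes the
      trace of the cube as (-1) * 1 - 1 = -2.\<close>
    have "?T (x \<otimes> x \<otimes> inv x) = ?T (x \<otimes> x) * ?T x - ?T (x \<otimes> x \<otimes> x)" using b 2 by (intro rotations_trace_inv)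
    then have m: "?T (x \<otimes> x \<otimes> x) = -2" "x \<otimes> x \<otimes> x \<in> rotations"
      using b 2 c[OF b(1)] by (simp_all add: m_assoc rotations_mult)
    have "x \<otimes> x \<otimes> x \<otimes> (x \<otimes> x \<otimes> x) = \<one>"
      using m by (intro rotations_trace_2) (simp_all add: trace_rep_square rotations_mult)
    then have "x [^] (6::nat) = \<one>" using c[OF b(1)] by (simp add: numeral_eq_Suc m_assoc)
    moreover have "y \<in> generate G {x}" if y: "y \<in> rotations" for y
    proof -
      have xy: "x \<otimes> y \<in> rotations" using b y rotations_mult by blast
      have xy': "x \<otimes> inv y \<in> rotations" using b y rotations_mult rotations_inv by blast
      have e: "1 + (?T y)\<^sup>2 + (?T (x \<otimes> y))\<^sup>2 - ?T y * ?T (x \<otimes> y) = 4" using rotations_trace_eq[OF b(1) y] b by simp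
      have i: "?T (x \<otimes> inv y) = ?T y - ?T (x \<otimes> y)" using rotations_trace_inv[OF b(1) y] b by simp
      \<comment> \<open>For the traces y and z of \<open>y\<close> and \<open>x y\<close>, the
        equation is y^2 - y z + z^2 = 3. Its solutions have an entry 2 or -2, except (1,-1) and
        (-1,1), where y - z is 2 or -2.\<close>
      consider "?T y = 2" | "?T y = -2" | "?T (x \<otimes> y) = 2" | "?T (x \<otimes> y) = -2" | "?T (x \<otimes> inv y) = 2" | "?T (x \<otimes> inv y) = -2"
        using T[OF y] T[OF xy] e i by auto
      then show ?thesis
      proof cases
        case 2 then have "y = x \<otimes> x \<otimes> x" using m y by (intro rotation_eqI)
        then show ?thesis using x mult by blast
      next
        case 4 then have "x \<otimes> y = x \<otimes> x \<otimes> x" using m xy by (intro rotation_eqI)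
        then have "y = x \<otimes> x" using b y c by (simp add: m_assoc)
        then show ?thesis using x mult by blast
      next
        case 6 then have "x \<otimes> inv y = x \<otimes> x \<otimes> x" using m xy' by (intro rotation_eqI)
        then have "inv y = x \<otimes> x" using b y c by (simp add: m_assoc)
        then have "y = inv x \<otimes> inv x" using b y c by (metis inv_inv inv_mult_group)
        then show ?thesis using mult generate.inv[of x "{x}"] by blast
      qed (use one inv eq b y in auto)
    qed
    ultimately show ?thesis using b by (intro rotations_cyclicI[of x 6]) auto
  next
    case c
    have 2: "?T (x \<otimes> x) = -1" "x \<otimes> x \<in> rotations" using c by (simp_all add: trace_rep_square rotations_mult)
    have "?T (x \<otimes> x \<otimes> inv x) = ?T (x \<otimes> x) * ?T x - ?T (x \<otimes> x \<otimes> x)" using c 2 by (intro rotations_trace_inv)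
    then have "x \<otimes> x \<otimes> x = \<one>"
      using c 2 rotations_carrier[OF c(1)] by (intro rotations_trace_2) (simp_all add: m_assoc rotations_mult)
    then have "x [^] (3::nat) = \<one>" using rotations_carrier[OF c(1)] by (simp add: numeral_eq_Suc m_assoc)
    moreover have "y \<in> generate G {x}" if y: "y \<in> rotations" for y
    proof -
      have xy: "x \<otimes> y \<in> rotations" using c y rotations_mult by blast
      have e: "1 + (?T y)\<^sup>2 + (?T (x \<otimes> y))\<^sup>2 + ?T y * ?T (x \<otimes> y) = 4" using rotations_trace_eq[OF c(1) y] c by simp
      have i: "?T (x \<otimes> inv y) = - ?T y - ?T (x \<otimes> y)" using rotations_trace_inv[OF c(1) y] c by simp
      \<comment> \<open>Now y^2 + y z + z^2 = 3 without the values 0 and 1 leaves (2,-1), (-1,2) and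
        (-1,-1); the last one gives trace 2 to \<open>x \<otimes> inv y\<close>.\<close>
      have "?T y = 2 \<or> ?T (x \<otimes> y) = 2 \<or> ?T (x \<otimes> inv y) = 2"
        using T[OF y] T[OF xy] e i c(3,4)[OF y] c(3,4)[OF xy] by auto
      then show ?thesis using one inv eq c(1) y by blast
    qed
    ultimately show ?thesis using c by (intro rotations_cyclicI[of x 3]) auto
  next
    case d
    show ?thesis
    proof (cases "\<exists>x\<in>rotations. ?T x = -2")
      case True
      then obtain x where x: "x \<in> rotations" "?T x = -2" by blast
      have "x \<otimes> x = \<one>" using x by (intro rotations_trace_2) (simp_all add: trace_rep_square rotations_mult)
      then have "x [^] (2::nat) = \<one>" using c[OF x(1)] by (simp add: numeral_eq_Suc)
      moreover have "y \<in> generate G {x}" if y: "y \<in> rotations" for y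
        using d[OF y] one[OF y] rotation_eqI[OF y x(1) _ x(2)] by (auto intro: generate.incl)
      ultimately show ?thesis using x by (intro rotations_cyclicI[of x 2]) auto
    next
      case False
      then show ?thesis using d one one_rotation by (intro rotations_cyclicI[of \<one> 1]) auto
    qed
  qed
qed

lemma reflection_exists: "rotations \<noteq> carrier G \<Longrightarrow> \<exists>s\<in>carrier G. det (\<phi> s) = -1"
  using det_rep by (auto simp: rotations_def)

text \<open>If \<open>s\<close> has determinant -1, then so has \<open>s \<otimes> r\<close>. Both
  are involutions, which is the dihedral relation, and multiplication by \<open>s\<close> exchanges
  the rotations with the remaining elements.\<close>

theorem classification:
  defines "n \<equiv> card rotations"
  shows "n \<in> {1,2,3,4,6}"
    and "rotations = carrier G \<Longrightarrow> G \<cong> integer_mod_group n"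
    and "rotations \<noteq> carrier G \<Longrightarrow> G \<cong> dihedral_group n"
proof -
  obtain r where r: "r \<in> rotations" "ord r \<in> {1,2,3,4,6}" "rotations = generate G {r}"
    using rotations_cyclic by blast
  have rc: "r \<in> carrier G" using r rotations_carrier by blast
  have n: "n = ord r" unfolding n_def r(3) using generate_pow_card[OF rc] by simp
  have pos: "ord r > 0" using r(2) by auto
  show "n \<in> {1,2,3,4,6}" using n r by blast
  show "G \<cong> integer_mod_group n" if "rotations = carrier G"
    unfolding n using rc pos that r by (intro iso_integer_mod_groupI) auto
  show "G \<cong> dihedral_group n" if refl: "rotations \<noteq> carrier G"
  proof -
    obtain s where s: "s \<in> carrier G" "det (\<phi> s) = -1"
      using reflection_exists[OF refl] by blast
    have ss: "s \<otimes> s = \<one>" using s by (rule reflections_involutive)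
    have "s \<otimes> r \<otimes> (s \<otimes> r) = \<one>"
      using s rc rotations_det[OF r(1)] by (intro reflections_involutive) (simp_all add: rep_mult det_mul)
    then have "s \<otimes> r \<otimes> s = inv r"
      using s rc by (metis inv_equality m_assoc m_closed)
    moreover have "s \<notin> generate G {r}" using s rotations_det r(3) by fastforce
    moreover have "x \<in> (\<lambda>x. x \<otimes> s) ` generate G {r}" if x: "x \<in> carrier G" "x \<notin> generate G {r}" for x
    proof
      show "x = x \<otimes> s \<otimes> s" using x s ss by (simp add: m_assoc)
      show "x \<otimes> s \<in> generate G {r}"
        using x s det_rep[OF x(1)] unfolding r(3)[symmetric] by (auto simp: rotations_def rep_mult det_mul)
    qed
    then have "carrier G = generate G {r} \<union> (\<lambda>x. x \<otimes> s) ` generate G {r}"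
      using s(1) rotations_carrier r(3) by blast
    ultimately show ?thesis unfolding n using rc pos s(1) ss by (intro iso_dihedral_groupI)
  qed
qed

text \<open>Serves the convention for \<open>Cyclic 2\<close>. The nontrivial rotation squares to
  the identity, so 2 = t^2 - 2 for its trace t, and t = 2 would make it trivial.\<close>

lemma two_rotations:
  assumes "card rotations = 2"
  obtains m where "m \<in> rotations" "\<phi> m = - mat 1" "rotations = {\<one>, m}"
proof -
  obtain m where m: "m \<noteq> \<one>" "rotations = {\<one>, m}"
    using assms one_rotation unfolding card_2_iff by (metis insertE insert_commute singletonD)
  then have mr: "m \<in> rotations" by blast
  have "m \<otimes> m \<noteq> m" using m(1) rotations_carrier[OF mr] by (metis l_cancel_one')
  then have "m \<otimes> m = \<one>" using rotations_mult[OF mr mr] m(2) by blast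
  then have "trace (mat 1 :: int^2^2) = (trace (\<phi> m))\<^sup>2 - 2" using trace_rep_square[OF mr] by (simp add: rep_one)
  then have "(trace (\<phi> m))\<^sup>2 = 2\<^sup>2" by (simp add: mat2)
  then have "trace (\<phi> m) = 2 \<or> trace (\<phi> m) = -2" by (simp only: power2_eq_iff)
  then have "\<phi> m = - mat 1" using rotations_trace_2 rotations_trace_minus_2 mr m(1) by blast
  with mr m(2) that show ?thesis by blast
qed

text \<open>Serves the convention for \<open>Dihedral 1\<close>. Two elements of determinant -1 have
  a rotation as product, here the identity, so they coincide.\<close>

lemma one_rotation_only:
  assumes "card rotations = 1" "rotations \<noteq> carrier G"
  obtains s where "s \<in> carrier G" "det (\<phi> s) = -1" "carrier G = {\<one>, s}"
proof -
  obtain s where s: "s \<in> carrier G" "det (\<phi> s) = -1"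
    using reflection_exists[OF assms(2)] by blast
  have R: "rotations = {\<one>}" using assms(1) one_rotation by (auto simp: card_1_singleton_iff)
  have "x = s" if x: "x \<in> carrier G" "x \<noteq> \<one>" for x
  proof -
    have "det (\<phi> x) = -1" using x R det_rep[OF x(1)] by (auto simp: rotations_def)
    then have "x \<otimes> s \<in> rotations" using x s by (simp add: rotations_def rep_mult det_mul)
    then have "x \<otimes> s = s \<otimes> s" using R reflections_involutive[OF s] by auto
    then show ?thesis using x s by simp
  qed
  with s that show ?thesis by blast
qed

end

subsection \<open>Lattices and their bases\<close>

lemma Z_basis_iff:
  fixes B N :: "'v::real_vector set"
  shows "Z_basis B N \<Longrightarrow> x \<in> N \<longleftrightarrow> (\<exists>c::'v\<Rightarrow>int. x = (\<Sum>b\<in>B. of_int (c b) *\<^sub>R b))"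
  by (auto simp: Z_basis_def Z_span_def)

lemma Z_basis_memI: "Z_basis B N \<Longrightarrow> x = (\<Sum>b\<in>B. of_int (c b) *\<^sub>R b) \<Longrightarrow> x \<in> N"
  unfolding Z_basis_iff by (rule exI[of _ c])

lemma Z_basis_finite: "Z_basis B N \<Longrightarrow> finite B"
  by (simp add: Z_basis_def)

lemma Z_basis_coeff_unique:
  fixes B N :: "'v::real_vector set" and c d :: "'v \<Rightarrow> int"
  assumes "Z_basis B N" "(\<Sum>b\<in>B. of_int (c b) *\<^sub>R b) = (\<Sum>b\<in>B. of_int (d b) *\<^sub>R b)" "b \<in> B"
  shows "c b = d b"
proof -
  have "(\<Sum>b\<in>B. of_int (c b - d b) *\<^sub>R b) = 0"
    using assms(2) by (simp add: algebra_simps sum_subtractf)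
  then have "\<forall>b\<in>B. c b - d b = 0"
    using assms(1) unfolding Z_basis_def by (elim conjE allE[of _ "\<lambda>b. c b - d b"]) blast
  then show ?thesis using assms(3) by simp
qed

lemma Z_basis_zero: "Z_basis B N \<Longrightarrow> 0 \<in> N"
  by (rule Z_basis_memI[of _ _ _ "\<lambda>_. 0"]) simp_all

lemma Z_basis_add:
  assumes B: "Z_basis B N" and "x \<in> N" "y \<in> N"
  shows "x + y \<in> N"
proof -
  obtain c d where "x = (\<Sum>b\<in>B. of_int (c b) *\<^sub>R b)" "y = (\<Sum>b\<in>B. of_int (d b) *\<^sub>R b)"
    using assms(2,3) Z_basis_iff[OF B] by blast
  then have "x + y = (\<Sum>b\<in>B. of_int (c b + d b) *\<^sub>R b)"
    by (simp add: scaleR_left_distrib sum.distrib)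
  then show ?thesis by (rule Z_basis_memI[OF B])
qed

lemma Z_basis_scale:
  assumes B: "Z_basis B N" and "x \<in> N"
  shows "of_int k *\<^sub>R x \<in> N"
proof -
  obtain c where "x = (\<Sum>b\<in>B. of_int (c b) *\<^sub>R b)"
    using assms(2) Z_basis_iff[OF B] by blast
  then have "of_int k *\<^sub>R x = (\<Sum>b\<in>B. of_int (k * c b) *\<^sub>R b)"
    by (simp add: scaleR_sum_right)
  then show ?thesis by (rule Z_basis_memI[OF B])
qed

lemma Z_basis_uminus: "\<lbrakk>Z_basis B N; x \<in> N\<rbrakk> \<Longrightarrow> - x \<in> N"
  using Z_basis_scale[of B N x "-1"] by simp

lemma Z_basis_diff: "\<lbrakk>Z_basis B N; x \<in> N; y \<in> N\<rbrakk> \<Longrightarrow> x - y \<in> N"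
  using Z_basis_add[of B N x "- y"] Z_basis_uminus by fastforce

lemma Z_basis_sum:
  assumes "Z_basis B N" "\<And>i. i \<in> I \<Longrightarrow> f i \<in> N"
  shows "(\<Sum>i\<in>I. f i) \<in> N"
  using assms(2) by (induction I rule: infinite_finite_induct)
    (auto intro: Z_basis_add[OF assms(1)] Z_basis_zero[OF assms(1)])

lemma Z_basis_subset:
  assumes "Z_basis B N"
  shows "B \<subseteq> N"
proof
  fix b assume b: "b \<in> B"
  have "(\<Sum>b'\<in>B. of_int ((\<lambda>b'. if b' = b then 1 else 0) b') *\<^sub>R b') = (\<Sum>b'\<in>B. if b' = b then b' else 0)"
    by (intro sum.cong) auto
  also have "\<dots> = b" using b Z_basis_finite[OF assms] by simp
  finally show "b \<in> N" by (intro Z_basis_memI[OF assms]) (rule sym)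
qed

lemma additive_scale_int:
  fixes N :: "'v::real_vector set" and h :: "'v \<Rightarrow> 'w::real_vector"
  assumes B: "Z_basis B N" and add: "\<And>x y. \<lbrakk>x \<in> N; y \<in> N\<rbrakk> \<Longrightarrow> h (x + y) = h x + h y" and x: "x \<in> N"
  shows "h (of_int k *\<^sub>R x) = of_int k *\<^sub>R h x"
proof -
  have 0: "h 0 = 0" using add[of 0 0] Z_basis_zero[OF B] by simp
  have nat: "h (of_int (int n) *\<^sub>R x) = of_int (int n) *\<^sub>R h x" for n
  proof (induction n)
    case (Suc n)
    have "h (of_int (int n) *\<^sub>R x + x) = of_int (int n) *\<^sub>R h x + h x"
      using Suc add x Z_basis_scale[OF B x] by metis
    then show ?case by (simp add: algebra_simps)
  qed (use 0 in simp)
  show ?thesis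
  proof (cases k rule: int_cases2)
    case (nonpos n)
    have "h (of_int (int n) *\<^sub>R x + of_int k *\<^sub>R x) = of_int (int n) *\<^sub>R h x + h (of_int k *\<^sub>R x)"
      using add Z_basis_scale[OF B x] nat by metis
    then have "of_int (int n) *\<^sub>R h x + h (of_int k *\<^sub>R x) = 0" using 0 nonpos by simp
    then have "h (of_int k *\<^sub>R x) = - (of_int (int n) *\<^sub>R h x)" by (simp only: add_eq_0_iff)
    then show ?thesis using nonpos by simp
  qed (use nat in simp)
qed

lemma additive_sum:
  fixes N :: "'v::real_vector set" and h :: "'v \<Rightarrow> 'w::real_vector"
  assumes B: "Z_basis B N" and add: "\<And>x y. \<lbrakk>x \<in> N; y \<in> N\<rbrakk> \<Longrightarrow> h (x + y) = h x + h y"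
    and x: "\<And>i. i \<in> I \<Longrightarrow> x i \<in> N"
  shows "h (\<Sum>i\<in>I. of_int (c i) *\<^sub>R x i) = (\<Sum>i\<in>I. of_int (c i) *\<^sub>R h (x i))"
  using x
proof (induction I rule: infinite_finite_induct)
  case (insert i I)
  then have "(\<Sum>i\<in>I. of_int (c i) *\<^sub>R x i) \<in> N"
    by (intro Z_basis_sum[OF B] Z_basis_scale[OF B]) auto
  with insert show ?case
    by (simp add: add Z_basis_scale[OF B] additive_scale_int[OF B add])
qed (use add[of 0 0] Z_basis_zero[OF B] in auto)

text \<open>The codomain is left general: \<open>h\<close> will be an automorphism of the lattice,
  but also a real-valued coordinate function.\<close>

lemma lattice_linear_extension:
  fixes N :: "'v::real_vector set" and h :: "'v \<Rightarrow> 'w::real_vector"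
  assumes N: "full_lattice r N" and add: "\<And>x y. \<lbrakk>x \<in> N; y \<in> N\<rbrakk> \<Longrightarrow> h (x + y) = h x + h y"
  obtains f where "linear f" "\<And>x. x \<in> N \<Longrightarrow> f x = h x"
proof -
  obtain B where B: "Z_basis B N" "independent B"
    using N unfolding full_lattice_def by blast
  have "\<exists>f. linear f \<and> (\<forall>x\<in>B. f x = h x)"
    by (rule linear_independent_extend[OF B(2)])
  then obtain f where f: "linear f" "\<forall>x\<in>B. f x = h x" by (elim exE conjE)
  have "f x = h x" if xN: "x \<in> N" for x
  proof -
    obtain c where x: "x = (\<Sum>b\<in>B. of_int (c b) *\<^sub>R b)"
      using xN Z_basis_iff[OF B(1)] by blast
    have "f x = (\<Sum>b\<in>B. of_int (c b) *\<^sub>R f b)"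
      unfolding x by (simp add: linear_sum[OF f(1)] linear_scale[OF f(1)])
    also have "\<dots> = (\<Sum>b\<in>B. of_int (c b) *\<^sub>R h b)" using f(2) by simp
    also have "\<dots> = h x"
      unfolding x using Z_basis_subset[OF B(1)] by (intro additive_sum[OF B(1) add, symmetric]) auto
    finally show ?thesis .
  qed
  with f(1) that show ?thesis by blast
qed

lemma lattice_linear_eq:
  assumes "full_lattice r N" "linear f" "linear g" "\<And>x. x \<in> N \<Longrightarrow> f x = g x"
  shows "f = g"
proof -
  obtain B where B: "Z_basis B N" "span B = UNIV"
    using assms(1) unfolding full_lattice_def by blast
  show ?thesis
    using linear_eq_on_span[OF assms(2,3), of B] Z_basis_subset[OF B(1)] assms(4) B(2) by blast
qed

text \<open>\<open>full_lattice\<close> provides real independence for one basis only, whereas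
  \<open>B\<close> is any basis over the integers. Its coordinate functions are additive on
  \<open>N\<close>, so they extend linearly to the whole space and form the dual basis.\<close>

lemma Z_basis_dual:
  fixes N :: "'v::real_vector set"
  assumes N: "full_lattice r N" and B: "Z_basis B N"
  obtains F :: "'v \<Rightarrow> 'v \<Rightarrow> real" where
    "\<And>b. b \<in> B \<Longrightarrow> linear (F b)"
    "\<And>b x. \<lbrakk>b \<in> B; x \<in> N\<rbrakk> \<Longrightarrow> F b x \<in> \<int>"
    "\<And>b b'. \<lbrakk>b \<in> B; b' \<in> B\<rbrakk> \<Longrightarrow> F b b' = (if b = b' then 1 else 0)"
proof -
  obtain c :: "'v \<Rightarrow> 'v \<Rightarrow> int" where c: "x = (\<Sum>b\<in>B. of_int (c x b) *\<^sub>R b)" if "x \<in> N" for x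
    using Z_basis_iff[OF B] by metis
  have uniq: "c x b = d b" if "x = (\<Sum>b\<in>B. of_int (d b) *\<^sub>R b)" "b \<in> B" for x d b
    using c[OF Z_basis_memI[OF B that(1)]] that by (intro Z_basis_coeff_unique[OF B]) simp_all
  have ex: "\<exists>f. linear f \<and> (\<forall>x\<in>N. f x = real_of_int (c x b))" if "b \<in> B" for b
  proof -
    have "of_int (c (x + y) b) = (of_int (c x b) + of_int (c y b) :: real)" if "x \<in> N" "y \<in> N" for x y
    proof -
      have "c (x + y) b = c x b + c y b"
        using c[OF that(1)] c[OF that(2)] \<open>b \<in> B\<close>
        by (intro uniq) (simp_all add: algebra_simps sum.distrib)
      then show ?thesis by simp
    qed
    then obtain f where "linear f" "\<And>x. x \<in> N \<Longrightarrow> f x = (of_int (c x b) :: real)"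
      by (rule lattice_linear_extension[OF N]) blast+
    then show ?thesis by blast
  qed
  obtain F where F: "linear (F b)" "\<forall>x\<in>N. F b x = real_of_int (c x b)" if "b \<in> B" for b
    using ex by metis
  have "F b b' = (if b = b' then 1 else 0)" if "b \<in> B" "b' \<in> B" for b b'
  proof -
    have "(\<Sum>b\<in>B. of_int (if b = b' then 1 else 0) *\<^sub>R b) = (\<Sum>b\<in>B. if b = b' then b else 0)"
      by (intro sum.cong) auto
    also have "\<dots> = b'" using that Z_basis_finite[OF B] by simp
    finally have "c b' b = (if b = b' then 1 else 0)" using that by (intro uniq) auto
    then show ?thesis using F(2)[OF that(1)] Z_basis_subset[OF B] that(2) by auto
  qed
  with F that[of F] show ?thesis by auto
qed

lemma dual_linear_combination:
  fixes B :: "'v::real_vector set" and F :: "'v \<Rightarrow> 'v \<Rightarrow> real"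
  assumes "finite B" "linear (F b)" "b \<in> B" "\<And>b b'. \<lbrakk>b \<in> B; b' \<in> B\<rbrakk> \<Longrightarrow> F b b' = (if b = b' then 1 else 0)"
    and "S \<subseteq> B"
  shows "F b (\<Sum>s\<in>S. c s *\<^sub>R s) = (if b \<in> S then c b else 0)"
proof -
  have "F b (\<Sum>s\<in>S. c s *\<^sub>R s) = (\<Sum>s\<in>S. c s * F b s)"
    by (simp add: linear_sum[OF assms(2)] linear_scale[OF assms(2)])
  also have "\<dots> = (\<Sum>s\<in>S. if b = s then c b else 0)"
    using assms(3-5) by (intro sum.cong) auto
  also have "\<dots> = (if b \<in> S then c b else 0)"
    using finite_subset[OF assms(5,1)] by simp
  finally show ?thesis .
qed

subsection \<open>Cones generated by part of a basis\<close>

lemma convex_cone_hull_finite: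
  fixes S :: "'v::real_vector set"
  assumes "finite S"
  shows "convex_cone hull S = {\<Sum>s\<in>S. c s *\<^sub>R s | c. \<forall>s\<in>S. 0 \<le> c s}" (is "_ = ?C")
proof (rule antisym)
  show "?C \<subseteq> convex_cone hull S"
  proof safe
    fix c :: "'v \<Rightarrow> real" assume c: "\<forall>s\<in>S. 0 \<le> c s"
    have "(\<Sum>s\<in>T. c s *\<^sub>R s) \<in> convex_cone hull S" if "T \<subseteq> S" for T
      using finite_subset[OF that assms] that
    proof (induction T rule: finite_induct)
      case (insert t T)
      then have "c t *\<^sub>R t \<in> convex_cone hull S"
        using c by (intro convex_cone_hull_mul hull_inc) auto
      with insert show ?case by (simp add: convex_cone_hull_add)
    qed (simp add: convex_cone_hull_contains_0)
    then show "(\<Sum>s\<in>S. c s *\<^sub>R s) \<in> convex_cone hull S" by blast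
  qed
  show "convex_cone hull S \<subseteq> ?C"
  proof (rule hull_minimal)
    show "S \<subseteq> ?C"
    proof
      fix s assume s: "s \<in> S"
      have "s = (\<Sum>t\<in>S. if t = s then t else 0)" using s assms by simp
      also have "\<dots> = (\<Sum>t\<in>S. (if t = s then 1 else 0) *\<^sub>R t)" by (intro sum.cong) auto
      finally show "s \<in> ?C" by fastforce
    qed
    show "convex_cone ?C"
      unfolding convex_cone_iff
    proof (intro conjI ballI allI impI)
      show "0 \<in> ?C" by (rule CollectI, rule exI[of _ "\<lambda>_. 0"]) simp
    next
      fix x y assume "x \<in> ?C" "y \<in> ?C"
      then obtain c d where "x = (\<Sum>s\<in>S. c s *\<^sub>R s)" "y = (\<Sum>s\<in>S. d s *\<^sub>R s)"
        "\<forall>s\<in>S. 0 \<le> c s" "\<forall>s\<in>S. 0 \<le> d s" by auto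
      then show "x + y \<in> ?C"
        by (intro CollectI exI[of _ "\<lambda>s. c s + d s"]) (simp add: scaleR_left_distrib sum.distrib)
    next
      fix x and k :: real assume "x \<in> ?C" "0 \<le> k"
      then obtain c where "x = (\<Sum>s\<in>S. c s *\<^sub>R s)" "\<forall>s\<in>S. 0 \<le> c s" by auto
      then show "k *\<^sub>R x \<in> ?C" using \<open>0 \<le> k\<close>
        by (intro CollectI exI[of _ "\<lambda>s. k * c s"]) (simp add: scaleR_sum_right)
    qed
  qed
qed

text \<open>The Hilbert basis of the monoid of lattice points of the cone. It depends only on cone
  and lattice, so automorphisms transport it, and it recovers the generators of a smooth
  cone.\<close>

definition indecomposables :: "'v::real_vector set \<Rightarrow> 'v set \<Rightarrow> 'v set" where
  "indecomposables N \<sigma> =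
     {x \<in> \<sigma> \<inter> N. x \<noteq> 0 \<and> (\<forall>y\<in>\<sigma> \<inter> N. \<forall>z\<in>\<sigma> \<inter> N. x = y + z \<longrightarrow> y = 0 \<or> z = 0)}"

lemma indecomposables_image:
  assumes "linear f" "inj f" "f ` N = N"
  shows "indecomposables N (f ` \<sigma>) = f ` indecomposables N \<sigma>"
proof -
  have 1: "f ` \<sigma> \<inter> N = f ` (\<sigma> \<inter> N)" using assms by (metis image_Int)
  have 2: "f x = 0 \<longleftrightarrow> x = 0" for x using assms(1,2) by (simp add: linear_injective_0 linear_0) 
      (metis assms(1,2) injD linear_0)
  have 3: "f x = f y + f z \<longleftrightarrow> x = y + z" for x y z
    using assms(1,2) by (metis injD linear_add)
  show ?thesis unfolding indecomposables_def 1 Compr_image_eq by (simp add: 2 3)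
qed

text \<open>A nonzero lattice point of the cone has some dual coordinate at least 1, so the
  corresponding generator can be subtracted without leaving the cone. Conversely, the sum of the
  coordinates shows that a generator does not split.\<close>

lemma indecomposables_cone:
  fixes N :: "'v::real_vector set"
  assumes N: "full_lattice r N" and B: "Z_basis B N" and S: "S \<subseteq> B"
  shows "indecomposables N (convex_cone hull S) = S"
proof -
  obtain F :: "'v \<Rightarrow> 'v \<Rightarrow> real" where F: "\<And>b. b \<in> B \<Longrightarrow> linear (F b)"
    "\<And>b x. \<lbrakk>b \<in> B; x \<in> N\<rbrakk> \<Longrightarrow> F b x \<in> \<int>"
    "\<And>b b'. \<lbrakk>b \<in> B; b' \<in> B\<rbrakk> \<Longrightarrow> F b b' = (if b = b' then 1 else 0)"
    using Z_basis_dual[OF N B] by blast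
  have fin: "finite S" using S Z_basis_finite[OF B] finite_subset by blast
  let ?C = "convex_cone hull S"
  have coord: "(\<Sum>s\<in>S. F s x *\<^sub>R s) = x" "\<And>s. s \<in> S \<Longrightarrow> 0 \<le> F s x" if x: "x \<in> ?C" for x
  proof -
    obtain c where c: "x = (\<Sum>s\<in>S. c s *\<^sub>R s)" "\<forall>s\<in>S. 0 \<le> c s"
      using x unfolding convex_cone_hull_finite[OF fin] by auto
    have "F s x = c s" if "s \<in> S" for s
      using dual_linear_combination[OF Z_basis_finite[OF B] F(1) _ F(3) S, of s c] that S unfolding c(1) by auto
    then show "(\<Sum>s\<in>S. F s x *\<^sub>R s) = x" "\<And>s. s \<in> S \<Longrightarrow> 0 \<le> F s x"
      using c by auto
  qed
  have nonzero: "s \<noteq> 0" if "s \<in> S" for s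
  proof
    assume "s = 0"
    then have "F s s = 0" using linear_0[OF F(1)[of s]] that S by auto
    moreover have "F s s = 1" using F(3)[of s s] that S by auto
    ultimately show False by simp
  qed
  have F1: "\<exists>s\<in>S. 1 \<le> F s x" if x: "x \<in> ?C" "x \<in> N" "x \<noteq> 0" for x
  proof -
    have "(\<Sum>s\<in>S. F s x *\<^sub>R s) \<noteq> 0" using coord(1)[OF x(1)] x(3) by simp
    then obtain s where "s \<in> S" "F s x *\<^sub>R s \<noteq> 0" by (rule sum.not_neutral_contains_not_neutral)
    then have s: "s \<in> S" "F s x \<noteq> 0" by auto
    then obtain k :: int where "F s x = of_int k" using F(2)[of s x] x(2) S by (auto elim!: Ints_cases)
    then have "1 \<le> F s x" using coord(2)[OF x(1) s(1)] s(2) by simp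
    with s(1) show ?thesis by blast
  qed
  show ?thesis
  proof (intro equalityI subsetI)
    fix x assume x: "x \<in> indecomposables N ?C"
    then have xC: "x \<in> ?C" "x \<in> N" "x \<noteq> 0" by (auto simp: indecomposables_def)
    then obtain s where s: "s \<in> S" "1 \<le> F s x" using F1 by blast
    have "x - s = (\<Sum>t\<in>S. F t x *\<^sub>R t) - (\<Sum>t\<in>S. if t = s then t else 0)"
      using coord(1)[OF xC(1)] s fin by simp
    moreover have "\<dots> = (\<Sum>t\<in>S. (F t x - (if t = s then 1 else 0)) *\<^sub>R t)"
      unfolding sum_subtractf[symmetric] by (intro sum.cong) (auto simp: algebra_simps)
    ultimately have "x - s \<in> ?C"
      unfolding convex_cone_hull_finite[OF fin] using coord(2)[OF xC(1)] s(2)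
      by (intro CollectI exI[of _ "\<lambda>t. F t x - (if t = s then 1 else 0)"]) auto
    moreover have "s \<in> N" "s \<in> ?C" using s S Z_basis_subset[OF B] by (auto intro: hull_inc)
    moreover have "s \<noteq> 0" using s nonzero by blast
    moreover have "x = s + (x - s)" by simp
    ultimately have "x - s = 0"
      using x Z_basis_diff[OF B xC(2)] unfolding indecomposables_def by blast
    then show "x \<in> S" using s by simp
  next
    fix s assume s: "s \<in> S"
    \<comment> \<open>\<open>L\<close> is a degree: additive, at least 1 on nonzero lattice points
      of the cone and equal to 1 on generators.\<close>
    define L where "L = (\<lambda>x. \<Sum>t\<in>S. F t x)"
    have L_add: "L (x + y) = L x + L y" for x y
      unfolding L_def sum.distrib[symmetric] using S F(1) by (intro sum.cong) (auto simp: linear_add)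
    have "L s = (\<Sum>t\<in>S. if t = s then 1 else 0)"
      unfolding L_def using F(3)[OF subsetD[OF S] subsetD[OF S]] s by (intro sum.cong) auto
    then have Ls: "L s = 1" using s fin by simp
    have L1: "1 \<le> L x" if x: "x \<in> ?C \<inter> N" "x \<noteq> 0" for x
    proof -
      obtain t where t: "t \<in> S" "1 \<le> F t x" using F1 x by blast
      note t(2)
      also have "F t x \<le> L x" unfolding L_def using coord(2)[of x] x t fin by (intro member_le_sum) auto
      finally show ?thesis .
    qed
    have "y = 0 \<or> z = 0" if "y \<in> ?C \<inter> N" "z \<in> ?C \<inter> N" "s = y + z" for y z
      using L1[of y] L1[of z] that L_add[of y z] Ls by force
    moreover have "s \<in> N" "s \<in> ?C" using s S Z_basis_subset[OF B] by (auto intro: hull_inc)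
    moreover have "s \<noteq> 0" using s nonzero by blast
    ultimately show "s \<in> indecomposables N ?C" unfolding indecomposables_def by blast
  qed
qed

subsection \<open>Automorphisms of plane lattices and fans\<close>

lemma generate_involution:
  assumes "group H" "x \<in> carrier H" "x \<otimes>\<^bsub>H\<^esub> x = \<one>\<^bsub>H\<^esub>"
  shows "generate H {x} = {\<one>\<^bsub>H\<^esub>, x}"
proof -
  interpret H: group H by fact
  have inv: "inv\<^bsub>H\<^esub> x = x" using assms H.inv_equality by blast
  have "y \<in> {\<one>\<^bsub>H\<^esub>, x}" if "y \<in> generate H {x}" for y
    using that by (induction rule: generate.induct) (use assms inv in auto)
  then show ?thesis by (auto intro: generate.one generate.incl)
qed

text \<open>The basis is indexed by the type \<open>2\<close>, so that the matrix of an automorphism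
  is an \<open>int^2^2\<close>.\<close>

locale planar_lattice =
  fixes N :: "'v::real_vector set" and e :: "2 \<Rightarrow> 'v"
  assumes inj_e: "inj e" and basis: "Z_basis (range e) N"
    and indep: "independent (range e)" and spans: "span (range e) = UNIV"
begin

lemma lattice: "full_lattice 2 N"
  using basis indep spans card_image[OF inj_e] unfolding full_lattice_def by fastforce

lemma sum_range: "(\<Sum>b\<in>range e. f b) = (\<Sum>i\<in>UNIV. f (e i))"
  using inj_e by (simp add: sum.reindex)

lemma mem_iff: "x \<in> N \<longleftrightarrow> (\<exists>c::2\<Rightarrow>int. x = (\<Sum>i\<in>UNIV. of_int (c i) *\<^sub>R e i))"
proof
  assume "x \<in> N"
  then obtain c where "x = (\<Sum>b\<in>range e. of_int (c b) *\<^sub>R b)" using Z_basis_iff[OF basis] by blast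
  then have "x = (\<Sum>i\<in>UNIV. of_int ((c \<circ> e) i) *\<^sub>R e i)" by (simp add: sum_range)
  then show "\<exists>c::2\<Rightarrow>int. x = (\<Sum>i\<in>UNIV. of_int (c i) *\<^sub>R e i)" by (rule exI[of _ "c \<circ> e"])
next
  assume "\<exists>c::2\<Rightarrow>int. x = (\<Sum>i\<in>UNIV. of_int (c i) *\<^sub>R e i)"
  then show "x \<in> N"
    using Z_basis_subset[OF basis] by (auto intro!: Z_basis_sum[OF basis] Z_basis_scale[OF basis])
qed

lemma basis_mem: "e i \<in> N"
  using Z_basis_subset[OF basis] by auto

lemma coeff_unique:
  fixes c d :: "2 \<Rightarrow> int"
  assumes "(\<Sum>i\<in>UNIV. of_int (c i) *\<^sub>R e i) = (\<Sum>i\<in>UNIV. of_int (d i) *\<^sub>R e i)"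
  shows "c = d"
proof
  fix i
  have "(c \<circ> inv_into UNIV e) (e i) = (d \<circ> inv_into UNIV e) (e i)"
    using assms by (intro Z_basis_coeff_unique[OF basis]) (simp_all add: sum_range inv_f_f[OF inj_e])
  then show "c i = d i" by (simp add: inv_f_f[OF inj_e])
qed

section \<open>The general linear group of the lattice: linear extensions and matrices\<close>

lemma group_additive: "group (additive_group N)"
proof (rule groupI)
  fix x assume "x \<in> carrier (additive_group N)"
  then show "\<exists>y\<in>carrier (additive_group N). y \<otimes>\<^bsub>additive_group N\<^esub> x = \<one>\<^bsub>additive_group N\<^esub>"
    using Z_basis_uminus[OF basis] by (intro bexI[of _ "- x"]) (auto simp: additive_group_def)
qed (auto simp: additive_group_def algebra_simps intro: Z_basis_add[OF basis] Z_basis_zero[OF basis])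

lemma group_GL: "group (GL_Z N)"
  unfolding GL_Z_def by (rule group.AutoGroup[OF group_additive])

lemma GL_carrier: "g \<in> carrier (GL_Z N) \<longleftrightarrow>
    g \<in> extensional N \<and> bij_betw g N N \<and> (\<forall>x\<in>N. \<forall>y\<in>N. g (x + y) = g x + g y)"
  by (auto simp: GL_Z_def AutoGroup_def auto_def Bij_def hom_def additive_group_def
      bij_betw_imp_funcset dest: bij_betwE)

lemma GL_one: "\<one>\<^bsub>GL_Z N\<^esub> = (\<lambda>x\<in>N. x)"
  by (simp add: GL_Z_def AutoGroup_def BijGroup_def additive_group_def)

lemma GL_mult: "\<lbrakk>g \<in> carrier (GL_Z N); h \<in> carrier (GL_Z N)\<rbrakk> \<Longrightarrow> g \<otimes>\<^bsub>GL_Z N\<^esub> h = compose N g h"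
  by (simp add: GL_carrier) (simp add: GL_Z_def AutoGroup_def BijGroup_def additive_group_def Bij_def)

text \<open>Elements of \<open>GL_Z N\<close> are maps on \<open>N\<close> with a default value
  elsewhere; their action on cones goes through this extension.\<close>

definition lin :: "('v \<Rightarrow> 'v) \<Rightarrow> 'v \<Rightarrow> 'v" where
  "lin g = (SOME f. linear f \<and> (\<forall>x\<in>N. f x = g x))"

lemma lin_unique: "\<lbrakk>linear f; \<And>x. x \<in> N \<Longrightarrow> f x = g x\<rbrakk> \<Longrightarrow> lin g = f"
  unfolding lin_def by (rule some_equality) (auto intro: lattice_linear_eq[OF lattice])

lemma lin:
  assumes "g \<in> carrier (GL_Z N)"
  shows linear_lin: "linear (lin g)" and lin_eq: "\<And>x. x \<in> N \<Longrightarrow> lin g x = g x"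
proof -
  obtain f where f: "linear f" "\<And>x. x \<in> N \<Longrightarrow> f x = g x"
    using assms by (rule_tac lattice_linear_extension[OF lattice, of g]) (auto simp: GL_carrier)
  moreover from this have "lin g = f" by (rule lin_unique)
  ultimately show "linear (lin g)" "\<And>x. x \<in> N \<Longrightarrow> lin g x = g x" by auto
qed

lemma GL_mem: "\<lbrakk>g \<in> carrier (GL_Z N); x \<in> N\<rbrakk> \<Longrightarrow> g x \<in> N"
  by (auto simp: GL_carrier dest: bij_betwE)

lemma lin_one: "lin \<one>\<^bsub>GL_Z N\<^esub> = id"
  by (rule lin_unique) (auto simp: GL_one linear_id)

lemma lin_mult:
  assumes "g \<in> carrier (GL_Z N)" "h \<in> carrier (GL_Z N)"
  shows "lin (g \<otimes>\<^bsub>GL_Z N\<^esub> h) = lin g \<circ> lin h"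
  using assms by (intro lin_unique linear_compose linear_lin)
    (auto simp: GL_mult compose_def lin_eq GL_mem)

lemma lin_inv:
  assumes "g \<in> carrier (GL_Z N)"
  shows "lin (inv\<^bsub>GL_Z N\<^esub> g) \<circ> lin g = id" "lin g \<circ> lin (inv\<^bsub>GL_Z N\<^esub> g) = id"
  using assms by (simp_all add: group.l_inv[OF group_GL] group.r_inv[OF group_GL] group.inv_closed[OF group_GL]
      lin_one flip: lin_mult)

lemma inj_lin: "g \<in> carrier (GL_Z N) \<Longrightarrow> inj (lin g)"
  using lin_inv(1) by (metis inj_on_id inj_on_imageI2)

lemma lin_image:
  assumes "g \<in> carrier (GL_Z N)"
  shows "lin g ` N = N"
proof -
  have "lin g ` N = g ` N" using assms by (intro image_cong) (simp_all add: lin_eq)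
  also have "\<dots> = N" using assms by (simp add: GL_carrier bij_betw_def)
  finally show ?thesis .
qed

text \<open>Images of basis vectors are the columns, as in \<open>lattice_reflection\<close>; hence
  products keep their order.\<close>

definition rep :: "('v \<Rightarrow> 'v) \<Rightarrow> int^2^2" where
  "rep g = (SOME A. \<forall>j. g (e j) = (\<Sum>i\<in>UNIV. of_int (A$i$j) *\<^sub>R e i))"

lemma rep_unique:
  assumes "\<And>j. g (e j) = (\<Sum>i\<in>UNIV. of_int (A$i$j) *\<^sub>R e i)"
  shows "rep g = A"
  unfolding rep_def
proof (rule some_equality)
  fix B :: "int^2^2"
  assume "\<forall>j. g (e j) = (\<Sum>i\<in>UNIV. of_int (B$i$j) *\<^sub>R e i)"
  then have "(\<lambda>i. B$i$j) = (\<lambda>i. A$i$j)" for j using assms by (intro coeff_unique) simp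
  then show "B = A" by (metis vec_eq_iff)
qed (use assms in blast)

lemma rep_eq:
  assumes "g \<in> carrier (GL_Z N)"
  shows "g (e j) = (\<Sum>i\<in>UNIV. of_int (rep g$i$j) *\<^sub>R e i)"
proof -
  have "\<forall>j. \<exists>c::2\<Rightarrow>int. g (e j) = (\<Sum>i\<in>UNIV. of_int (c i) *\<^sub>R e i)"
    using GL_mem[OF assms basis_mem] mem_iff by blast
  then obtain c :: "2 \<Rightarrow> 2 \<Rightarrow> int" where c: "\<And>j. g (e j) = (\<Sum>i\<in>UNIV. of_int (c j i) *\<^sub>R e i)"
    by metis
  then have "rep g = (\<chi> i j. c j i)" by (intro rep_unique) simp
  with c show ?thesis by simp
qed

lemma GL_linear_combination:
  fixes c :: "2 \<Rightarrow> int"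
  assumes "g \<in> carrier (GL_Z N)"
  shows "g (\<Sum>i\<in>UNIV. of_int (c i) *\<^sub>R e i) = (\<Sum>i\<in>UNIV. of_int (c i) *\<^sub>R g (e i))"
  using assms basis_mem by (intro additive_sum[OF basis]) (auto simp: GL_carrier)

lemma rep_mult:
  assumes "g \<in> carrier (GL_Z N)" "h \<in> carrier (GL_Z N)"
  shows "rep (g \<otimes>\<^bsub>GL_Z N\<^esub> h) = rep g ** rep h"
proof (rule rep_unique)
  fix j
  have "(g \<otimes>\<^bsub>GL_Z N\<^esub> h) (e j) = g (h (e j))"
    using assms basis_mem by (simp add: GL_mult compose_def)
  also have "\<dots> = (\<Sum>k\<in>UNIV. of_int (rep h$k$j) *\<^sub>R (\<Sum>i\<in>UNIV. of_int (rep g$i$k) *\<^sub>R e i))"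
    unfolding rep_eq[OF assms(2)] GL_linear_combination[OF assms(1)] rep_eq[OF assms(1)] ..
  also have "\<dots> = (\<Sum>i\<in>UNIV. of_int ((rep g ** rep h)$i$j) *\<^sub>R e i)"
    by (simp add: sum_2 mat2_mult_nth algebra_simps)
  finally show "(g \<otimes>\<^bsub>GL_Z N\<^esub> h) (e j) = (\<Sum>i\<in>UNIV. of_int ((rep g ** rep h)$i$j) *\<^sub>R e i)" .
qed

lemma rep_one: "rep \<one>\<^bsub>GL_Z N\<^esub> = mat 1"
proof (rule rep_unique)
  fix j
  show "\<one>\<^bsub>GL_Z N\<^esub> (e j) = (\<Sum>i\<in>UNIV. of_int ((mat 1 :: int^2^2)$i$j) *\<^sub>R e i)"
    using exhaust_2[of j] basis_mem by (auto simp: GL_one sum_2 mat2_one_nth)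
qed

lemma rep_inj: "inj_on rep (carrier (GL_Z N))"
proof (rule inj_onI)
  fix g h assume gh: "g \<in> carrier (GL_Z N)" "h \<in> carrier (GL_Z N)" "rep g = rep h"
  have "g x = h x" if xN: "x \<in> N" for x
  proof -
    obtain c :: "2 \<Rightarrow> int" where x: "x = (\<Sum>i\<in>UNIV. of_int (c i) *\<^sub>R e i)" using xN mem_iff by blast
    have "g (e i) = h (e i)" for i
      by (simp only: rep_eq[OF gh(1)] rep_eq[OF gh(2)] gh(3))
    then show ?thesis
      unfolding x GL_linear_combination[OF gh(1)] GL_linear_combination[OF gh(2)] by simp
  qed
  then show "g = h" using gh by (intro extensionalityI[of _ N]) (auto simp: GL_carrier)
qed

section \<open>Automorphism groups of smooth complete fans\<close>

lemma fan_aut_carrier: "g \<in> carrier (fan_aut N \<Sigma>) \<longleftrightarrow> g \<in> carrier (GL_Z N) \<and> bij_betw ((`) (lin g)) \<Sigma> \<Sigma>"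
  using lin lin_unique by (auto simp: fan_aut_def)

lemma subgroup_fan_aut: "subgroup (carrier (fan_aut N \<Sigma>)) (GL_Z N)"
proof (rule group.subgroupI[OF group_GL])
  show "carrier (fan_aut N \<Sigma>) \<subseteq> carrier (GL_Z N)" by (auto simp: fan_aut_carrier)
  have "\<one>\<^bsub>GL_Z N\<^esub> \<in> carrier (fan_aut N \<Sigma>)"
    by (simp add: fan_aut_carrier lin_one monoid.one_closed group.is_monoid[OF group_GL])
  then show "carrier (fan_aut N \<Sigma>) \<noteq> {}" by blast
next
  fix g assume g: "g \<in> carrier (fan_aut N \<Sigma>)"
  then have gG: "g \<in> carrier (GL_Z N)" "bij_betw ((`) (lin g)) \<Sigma> \<Sigma>" by (auto simp: fan_aut_carrier)
  let ?i = "lin (inv\<^bsub>GL_Z N\<^esub> g)"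
  have l: "?i ` lin g ` \<sigma> = \<sigma>" "lin g ` ?i ` \<sigma> = \<sigma>" for \<sigma>
    using lin_inv[OF gG(1)] by (simp_all add: image_comp)
  have im: "(`) (lin g) ` \<Sigma> = \<Sigma>" using gG(2) by (simp add: bij_betw_def)
  have "bij_betw ((`) ?i) \<Sigma> \<Sigma>"
  proof (rule bij_betw_byWitness[where f' = "(`) (lin g)"])
    show "(`) ?i ` \<Sigma> \<subseteq> \<Sigma>"
    proof
      fix \<tau> assume "\<tau> \<in> (`) ?i ` \<Sigma>"
      then obtain \<rho> where \<rho>: "\<rho> \<in> \<Sigma>" "\<tau> = ?i ` \<rho>" by auto
      obtain \<sigma> where \<sigma>: "\<sigma> \<in> \<Sigma>" "\<rho> = lin g ` \<sigma>" using \<rho>(1) im by (auto elim!: equalityE)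
      then show "\<tau> \<in> \<Sigma>" unfolding \<rho>(2) \<sigma>(2) l by simp
    qed
    show "(`) (lin g) ` \<Sigma> \<subseteq> \<Sigma>" unfolding im ..
  qed (simp_all add: l)
  then show "inv\<^bsub>GL_Z N\<^esub> g \<in> carrier (fan_aut N \<Sigma>)"
    using gG(1) by (simp add: fan_aut_carrier group.inv_closed[OF group_GL])
next
  fix g h assume "g \<in> carrier (fan_aut N \<Sigma>)" "h \<in> carrier (fan_aut N \<Sigma>)"
  then have gh: "g \<in> carrier (GL_Z N)" "h \<in> carrier (GL_Z N)"
    "bij_betw ((`) (lin g)) \<Sigma> \<Sigma>" "bij_betw ((`) (lin h)) \<Sigma> \<Sigma>" by (auto simp: fan_aut_carrier)
  have "(`) (lin (g \<otimes>\<^bsub>GL_Z N\<^esub> h)) = (`) (lin g) \<circ> (`) (lin h)"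
    using gh(1,2) by (simp add: lin_mult fun_eq_iff image_comp)
  then show "g \<otimes>\<^bsub>GL_Z N\<^esub> h \<in> carrier (fan_aut N \<Sigma>)"
    using gh bij_betw_trans[OF gh(4,3)]
    by (simp add: fan_aut_carrier monoid.m_closed group.is_monoid[OF group_GL])
qed

lemma fan_aut_eq: "fan_aut N \<Sigma> = (GL_Z N)\<lparr>carrier := carrier (fan_aut N \<Sigma>)\<rparr>"
  by (simp add: fan_aut_def)

lemma group_fan_aut: "group (fan_aut N \<Sigma>)"
  using subgroup.subgroup_is_group[OF subgroup_fan_aut group_GL] unfolding fan_aut_eq[symmetric] .

lemma fan_aut_indecomposables:
  assumes "g \<in> carrier (fan_aut N \<Sigma>)"
  shows "indecomposables N (lin g ` \<sigma>) = lin g ` indecomposables N \<sigma>"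
  using assms by (intro indecomposables_image) (auto simp: fan_aut_carrier linear_lin inj_lin lin_image)

lemma finite_fan_aut:
  assumes "smooth_fan N \<Sigma>" "complete_fan N \<Sigma>"
  shows "finite (carrier (fan_aut N \<Sigma>))"
proof -
  \<comment> \<open>The primitive generators of all rays. Completeness makes \<open>P\<close>
    spanning, so that an automorphism is determined by the self-map of the finite set
    \<open>P\<close> that it induces.\<close>
  define P where "P = (\<Union>\<sigma>\<in>\<Sigma>. indecomposables N \<sigma>)"
  have cone: "finite (indecomposables N \<sigma>)" "convex_cone hull indecomposables N \<sigma> = \<sigma>" if "\<sigma> \<in> \<Sigma>" for \<sigma>
  proof -
    obtain S B where SB: "Z_basis B N" "S \<subseteq> B" "\<sigma> = convex_cone hull S"
      using assms(1) \<open>\<sigma> \<in> \<Sigma>\<close> unfolding smooth_fan_def by meson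
    have "indecomposables N \<sigma> = S" unfolding SB(3) by (rule indecomposables_cone[OF lattice SB(1,2)])
    then show "finite (indecomposables N \<sigma>)" "convex_cone hull indecomposables N \<sigma> = \<sigma>"
      using SB finite_subset[OF SB(2) Z_basis_finite[OF SB(1)]] by simp_all
  qed
  have "finite \<Sigma>" using assms unfolding smooth_fan_def fan_def by blast
  then have finP: "finite P" unfolding P_def by (simp add: cone(1))
  have spanP: "x \<in> span P" for x
  proof -
    obtain \<sigma> where \<sigma>: "\<sigma> \<in> \<Sigma>" "x \<in> \<sigma>" using assms(2) unfolding complete_fan_def by blast
    then have "x \<in> convex_cone hull indecomposables N \<sigma>" by (simp add: cone(2))
    also have "\<dots> \<subseteq> span (indecomposables N \<sigma>)"
      by (intro hull_minimal span_superset convex_cone_span)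
    also have "\<dots> \<subseteq> span P" using \<sigma>(1) unfolding P_def by (intro span_mono) blast
    finally show ?thesis .
  qed
  have "inj_on (\<lambda>g. restrict (lin g) P) (carrier (fan_aut N \<Sigma>))"
  proof (rule inj_onI)
    fix g h assume gh: "g \<in> carrier (fan_aut N \<Sigma>)" "h \<in> carrier (fan_aut N \<Sigma>)"
      "restrict (lin g) P = restrict (lin h) P"
    then have gG: "g \<in> carrier (GL_Z N)" "h \<in> carrier (GL_Z N)" by (auto simp: fan_aut_carrier)
    have P: "lin g x = lin h x" if "x \<in> P" for x using gh(3) that by (metis restrict_apply')
    have "lin g x = lin h x" for x
      using linear_eq_on_span[OF linear_lin[OF gG(1)] linear_lin[OF gG(2)] P spanP] .
    then have "g x = h x" if "x \<in> N" for x
      using lin_eq[OF gG(1) that] lin_eq[OF gG(2) that] by simp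
    then show "g = h" using gG by (intro extensionalityI[of _ N]) (auto simp: GL_carrier)
  qed
  moreover have "(\<lambda>g. restrict (lin g) P) ` carrier (fan_aut N \<Sigma>) \<subseteq> P \<rightarrow>\<^sub>E P"
  proof safe
    fix g x assume g: "g \<in> carrier (fan_aut N \<Sigma>)" and "x \<in> P"
    then obtain \<sigma> where \<sigma>: "\<sigma> \<in> \<Sigma>" "x \<in> indecomposables N \<sigma>" unfolding P_def by blast
    then have "lin g x \<in> indecomposables N (lin g ` \<sigma>)" using fan_aut_indecomposables[OF g] by blast
    moreover have "lin g ` \<sigma> \<in> \<Sigma>" using g \<sigma>(1) by (auto simp: fan_aut_carrier dest: bij_betwE)
    ultimately have "lin g x \<in> P" unfolding P_def by blast
    with \<open>x \<in> P\<close> show "restrict (lin g) P x \<in> P" by simp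
  qed auto
  ultimately show ?thesis
    using finite_PiE[OF finP, of "\<lambda>_. P"] finP inj_on_finite by blast
qed

lemma finite_planar_group_fan_aut:
  assumes "smooth_fan N \<Sigma>" "complete_fan N \<Sigma>"
  shows "finite_planar_group (fan_aut N \<Sigma>) rep"
proof (intro finite_planar_group.intro finite_planar_group_axioms.intro)
  have mult: "monoid.mult (fan_aut N \<Sigma>) = monoid.mult (GL_Z N)" "\<one>\<^bsub>fan_aut N \<Sigma>\<^esub> = \<one>\<^bsub>GL_Z N\<^esub>"
    by (simp_all add: fan_aut_def)
  have sub: "carrier (fan_aut N \<Sigma>) \<subseteq> carrier (GL_Z N)" by (auto simp: fan_aut_carrier)
  show "inj_on rep (carrier (fan_aut N \<Sigma>))" using rep_inj sub inj_on_subset by blast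
  show "rep \<one>\<^bsub>fan_aut N \<Sigma>\<^esub> = mat 1" by (simp add: mult rep_one)
  show "rep (x \<otimes>\<^bsub>fan_aut N \<Sigma>\<^esub> y) = rep x ** rep y"
    if "x \<in> carrier (fan_aut N \<Sigma>)" "y \<in> carrier (fan_aut N \<Sigma>)" for x y
    using that sub by (simp add: mult rep_mult subset_iff)
qed (use assms in \<open>auto intro: group_fan_aut finite_fan_aut\<close>)

text \<open>The type is expressed by the number of automorphisms of determinant 1 and the presence
  of one of determinant -1, the two data that can be computed for examples.\<close>

theorem fan_aut_type:
  assumes "smooth_fan N \<Sigma>" "complete_fan N \<Sigma>"
  defines "n \<equiv> card {g \<in> carrier (fan_aut N \<Sigma>). det (rep g) = 1}"
  shows "n \<in> {1,2,3,4,6}"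
    and "(\<And>g. g \<in> carrier (fan_aut N \<Sigma>) \<Longrightarrow> det (rep g) \<noteq> -1) \<Longrightarrow> fan_aut_has_type N \<Sigma> (Cyclic n)"
    and "\<lbrakk>g \<in> carrier (fan_aut N \<Sigma>); det (rep g) = -1\<rbrakk> \<Longrightarrow> fan_aut_has_type N \<Sigma> (Dihedral n)"
proof -
  let ?A = "fan_aut N \<Sigma>"
  interpret A: finite_planar_group ?A rep using assms(1,2) by (rule finite_planar_group_fan_aut)
  have n: "n = card A.rotations" by (simp add: n_def A.rotations_def)
  show "n \<in> {1,2,3,4,6}" unfolding n by (rule A.classification)
  have one: "\<one>\<^bsub>?A\<^esub> = \<one>\<^bsub>GL_Z N\<^esub>" and mult: "monoid.mult ?A = monoid.mult (GL_Z N)" by (simp_all add: fan_aut_def)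
  have sub: "carrier ?A \<subseteq> carrier (GL_Z N)" by (auto simp: fan_aut_carrier)
  show "fan_aut_has_type N \<Sigma> (Cyclic n)" if nr: "\<And>g. g \<in> carrier ?A \<Longrightarrow> det (rep g) \<noteq> -1"
  proof -
    have R: "A.rotations = carrier ?A" using A.det_rep nr by (auto simp: A.rotations_def)
    \<comment> \<open>The nontrivial rotation has the matrix of \<open>neg_Id N\<close>, and
      matrices determine automorphisms.\<close>
    have "carrier ?A = generate (GL_Z N) {neg_Id N}" if n2: "n = 2"
    proof -
      obtain m where m: "m \<in> A.rotations" "rep m = - mat 1" "A.rotations = {\<one>\<^bsub>?A\<^esub>, m}"
        using n2 unfolding n by (rule A.two_rotations)
      have mG: "m \<in> carrier (GL_Z N)" using m(1) R sub by blast
      have neg: "neg_Id N \<in> carrier (GL_Z N)"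
        using Z_basis_uminus[OF basis] Z_basis_add[OF basis]
        by (auto simp: GL_carrier neg_Id_def intro!: bij_betw_byWitness[where f' = "\<lambda>x. - x"])
      have "rep (neg_Id N) = - mat 1"
      proof (rule rep_unique)
        fix j show "neg_Id N (e j) = (\<Sum>i\<in>UNIV. of_int ((- mat 1 :: int^2^2)$i$j) *\<^sub>R e i)"
          using exhaust_2[of j] basis_mem by (auto simp: neg_Id_def sum_2 mat2_one_nth)
      qed
      then have "m = neg_Id N" by (intro inj_onD[OF rep_inj _ mG neg]) (simp add: m(2))
      moreover have "neg_Id N \<otimes>\<^bsub>GL_Z N\<^esub> neg_Id N = \<one>\<^bsub>GL_Z N\<^esub>"
        using neg Z_basis_uminus[OF basis] by (auto simp: GL_mult GL_one compose_def neg_Id_def fun_eq_iff)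
      ultimately show ?thesis
        using generate_involution[OF group_GL neg] m(3) R one by simp
    qed
    then show ?thesis using A.classification(2)[OF R] n by simp
  qed
  show "fan_aut_has_type N \<Sigma> (Dihedral n)" if g: "g \<in> carrier ?A" "det (rep g) = -1"
  proof -
    have "g \<notin> A.rotations" using g(2) by (simp add: A.rotations_def)
    then have R: "A.rotations \<noteq> carrier ?A" using g(1) by blast
    have "\<exists>g. lattice_reflection N g \<and> carrier ?A = generate (GL_Z N) {g}" if n1: "n = 1"
    proof -
      obtain s where s: "s \<in> carrier ?A" "det (rep s) = -1" "carrier ?A = {\<one>\<^bsub>?A\<^esub>, s}"
        using n1 R unfolding n by (rule A.one_rotation_only)
      have sG: "s \<in> carrier (GL_Z N)" using s(1) sub by blast
      have ss: "s \<otimes>\<^bsub>GL_Z N\<^esub> s = \<one>\<^bsub>GL_Z N\<^esub>"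
        using A.reflections_involutive[OF s(1,2)] one mult by simp
      have "s \<noteq> \<one>\<^bsub>GL_Z N\<^esub>" using s(2) rep_one by auto
      moreover have "group.ord (GL_Z N) s dvd 2"
        using group.pow_eq_id[OF group_GL sG, of 2] ss sG
        by (simp add: numeral_2_eq_2 monoid.nat_pow_Suc monoid.nat_pow_0 group.is_monoid[OF group_GL]
            monoid.l_one)
      ultimately have "group.ord (GL_Z N) s = 2"
        using group.ord_eq_1[OF group_GL sG] by (auto simp: prime_nat_iff dest: prime_nat_iff[THEN iffD1, OF two_is_prime_nat, THEN conjunct2, rule_format])
      then have "lattice_reflection N s"
        unfolding lattice_reflection_def using sG inj_e basis rep_eq[OF sG] s(2) by blast
      moreover have "carrier ?A = generate (GL_Z N) {s}"
        using generate_involution[OF group_GL sG ss] s(3) one by simp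
      ultimately show ?thesis by blast
    qed
    then show ?thesis using A.classification(3)[OF R] n by simp
  qed
qed

end

lemma planar_lattice_exists:
  fixes N :: "'v::real_vector set"
  assumes "full_lattice 2 N"
  obtains e where "planar_lattice N e"
proof -
  obtain B where B: "card B = 2" "Z_basis B N" "independent B" "span B = UNIV"
    using assms unfolding full_lattice_def by blast
  obtain a b where ab: "B = {a, b}" "a \<noteq> b" using B(1) by (auto simp: card_2_iff)
  define e :: "2 \<Rightarrow> 'v" where "e = (\<lambda>i. if i = 1 then a else b)"
  have "range e = B" unfolding ab UNIV_2 e_def by auto
  moreover have "inj e" using ab(2) by (auto simp: inj_def e_def forall_2)
  ultimately show ?thesis using that[of e] B by (auto simp: planar_lattice_def)
qed

lemma fan_aut_planar_type:
  fixes N :: "'v::real_vector set"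
  assumes "full_lattice 2 N" "smooth_fan N \<Sigma>" "complete_fan N \<Sigma>"
  shows "\<exists>G\<in>planar_group_types. fan_aut_has_type N \<Sigma> G"
proof -
  obtain e where "planar_lattice N e" using assms(1) by (rule planar_lattice_exists)
  then interpret planar_lattice N e .
  let ?n = "card {g \<in> carrier (fan_aut N \<Sigma>). det (rep g) = 1}"
  have n: "?n \<in> {1,2,3,4,6}" using assms(2,3) by (rule fan_aut_type)
  consider "fan_aut_has_type N \<Sigma> (Cyclic ?n)" | "fan_aut_has_type N \<Sigma> (Dihedral ?n)"
    using fan_aut_type(2,3)[OF assms(2,3)] by blast
  moreover have "Cyclic ?n \<in> planar_group_types" "Dihedral ?n \<in> planar_group_types"
    using n by (auto simp: planar_group_types_def)
  ultimately show ?thesis by cases blast+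
qed

subsection \<open>Simplicial fans\<close>

lemma Z_basis_independent:
  fixes N :: "'v::real_vector set"
  assumes N: "full_lattice r N" and B: "Z_basis B N"
  shows "independent B"
proof -
  obtain F :: "'v \<Rightarrow> 'v \<Rightarrow> real" where F: "\<And>b. b \<in> B \<Longrightarrow> linear (F b)"
    "\<And>b x. \<lbrakk>b \<in> B; x \<in> N\<rbrakk> \<Longrightarrow> F b x \<in> \<int>"
    "\<And>b b'. \<lbrakk>b \<in> B; b' \<in> B\<rbrakk> \<Longrightarrow> F b b' = (if b = b' then 1 else 0)"
    using Z_basis_dual[OF N B] by blast
  have "c b = 0" if c: "(\<Sum>b\<in>B. c b *\<^sub>R b) = 0" and b: "b \<in> B" for c b
    using dual_linear_combination[OF Z_basis_finite[OF B] F(1)[OF b] b F(3) order_refl, of c]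
      linear_0[OF F(1)[OF b]] b unfolding c by simp
  then show ?thesis
    using Z_basis_finite[OF B] by (auto simp: dependent_finite)
qed

lemma strongly_convex_cone_hull:
  assumes S: "finite S" "independent S"
  shows "strongly_convex (convex_cone hull S)"
proof -
  have "x = 0" if x: "x \<in> convex_cone hull S" "- x \<in> convex_cone hull S" for x
  proof -
    obtain c d where c: "x = (\<Sum>s\<in>S. c s *\<^sub>R s)" "\<forall>s\<in>S. 0 \<le> c s"
      and d: "- x = (\<Sum>s\<in>S. d s *\<^sub>R s)" "\<forall>s\<in>S. 0 \<le> d s"
      using x unfolding convex_cone_hull_finite[OF S(1)] by blast
    have "(\<Sum>s\<in>S. (c s + d s) *\<^sub>R s) = 0"
      by (simp add: scaleR_left_distrib sum.distrib flip: c(1) d(1))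
    then have cd: "c s + d s = 0" if "s \<in> S" for s
      using independentD[OF S(2,1) order_refl, of "\<lambda>s. c s + d s"] that by simp
    have "c s = 0" if "s \<in> S" for s
      using cd[OF that] c(2) d(2) that by (metis add_nonneg_eq_0_iff)
    then show ?thesis unfolding c(1) by simp
  qed
  then show ?thesis
    unfolding strongly_convex_def by (force simp: convex_cone_hull_contains_0)
qed

text \<open>The supporting functional is nonnegative on the generators, so it vanishes at a
  nonnegative combination only if it vanishes at every generator with positive coefficient.\<close>

lemma face_of_cone_hull:
  fixes S :: "'v::real_vector set"
  assumes S: "finite S" and face: "cone_face \<tau> (convex_cone hull S)"
  obtains T where "T \<subseteq> S" "\<tau> = convex_cone hull T"
proof -
  obtain m :: "'v \<Rightarrow> real" where m: "linear m" "\<forall>x\<in>convex_cone hull S. 0 \<le> m x"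
    "\<tau> = {x \<in> convex_cone hull S. m x = 0}"
    using face unfolding cone_face_def by blast
  let ?T = "{s\<in>S. m s = 0}"
  have fin: "finite ?T" using S by simp
  have "\<tau> = convex_cone hull ?T"
  proof (intro equalityI subsetI)
    fix x assume "x \<in> \<tau>"
    then obtain c where c: "x = (\<Sum>s\<in>S. c s *\<^sub>R s)" "\<forall>s\<in>S. 0 \<le> c s" and mx: "m x = 0"
      unfolding m(3) convex_cone_hull_finite[OF S] by blast
    have "(\<Sum>s\<in>S. c s * m s) = 0"
      using mx unfolding c(1) by (simp add: linear_sum[OF m(1)] linear_scale[OF m(1)])
    moreover have "0 \<le> c s * m s" if "s \<in> S" for s
      using c(2) m(2) that by (simp add: hull_inc)
    ultimately have "\<forall>s\<in>S. c s * m s = 0" using S by (simp add: sum_nonneg_eq_0_iff)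
    then have "x = (\<Sum>s\<in>?T. c s *\<^sub>R s)"
      unfolding c(1) using S by (intro sum.mono_neutral_right) auto
    then show "x \<in> convex_cone hull ?T"
      unfolding convex_cone_hull_finite[OF fin] using c(2) by blast
  next
    fix x assume x: "x \<in> convex_cone hull ?T"
    then obtain c where c: "x = (\<Sum>s\<in>?T. c s *\<^sub>R s)"
      unfolding convex_cone_hull_finite[OF fin] by blast
    have "m x = 0" unfolding c by (simp add: linear_sum[OF m(1)] linear_scale[OF m(1)])
    moreover have "x \<in> convex_cone hull S" using x hull_mono[of ?T S convex_cone] by blast
    ultimately show "x \<in> \<tau>" unfolding m(3) by blast
  qed
  then show ?thesis using that[of ?T] by blast
qed

text \<open>Independence provides the supporting functional with value 0 on \<open>T\<close> and 1
  on the other generators.\<close>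

lemma cone_face_subset:
  fixes S :: "'v::real_vector set"
  assumes S: "finite S" "independent S" and T: "T \<subseteq> S"
  shows "cone_face (convex_cone hull T) (convex_cone hull S)"
proof -
  have "\<exists>m. linear m \<and> (\<forall>s\<in>S. m s = (if s \<in> T then 0 else 1 :: real))"
    by (rule linear_independent_extend[OF S(2)])
  then obtain m where m: "linear m" "\<And>s. s \<in> S \<Longrightarrow> m s = (if s \<in> T then 0 else 1 :: real)" by blast
  have finT: "finite T" using S(1) T finite_subset by blast
  have mS: "m (\<Sum>s\<in>S. c s *\<^sub>R s) = (\<Sum>s\<in>S - T. c s)" for c
  proof -
    have "m (\<Sum>s\<in>S. c s *\<^sub>R s) = (\<Sum>s\<in>S. c s * m s)"
      by (simp add: linear_sum[OF m(1)] linear_scale[OF m(1)])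
    also have "\<dots> = (\<Sum>s\<in>S - T. c s)"
      using S(1) by (intro sum.mono_neutral_cong_right) (auto simp: m(2))
    finally show ?thesis .
  qed
  show ?thesis
    unfolding cone_face_def
  proof (intro exI[of _ m] conjI m(1) ballI equalityI subsetI)
    fix x assume "x \<in> convex_cone hull S"
    then show "0 \<le> m x"
      unfolding convex_cone_hull_finite[OF S(1)] by (auto simp: mS intro!: sum_nonneg)
  next
    fix x assume x: "x \<in> convex_cone hull T"
    then obtain c where c: "x = (\<Sum>s\<in>T. c s *\<^sub>R s)"
      unfolding convex_cone_hull_finite[OF finT] by blast
    have "m x = (\<Sum>s\<in>T. c s * m s)"
      unfolding c by (simp add: linear_sum[OF m(1)] linear_scale[OF m(1)])
    also have "\<dots> = 0" using m(2) T by (intro sum.neutral) auto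
    finally show "x \<in> {x \<in> convex_cone hull S. m x = 0}"
      using x hull_mono[OF T, of convex_cone] by blast
  next
    fix x assume "x \<in> {x \<in> convex_cone hull S. m x = 0}"
    then obtain c where c: "x = (\<Sum>s\<in>S. c s *\<^sub>R s)" "\<forall>s\<in>S. 0 \<le> c s" and mx: "m x = 0"
      unfolding convex_cone_hull_finite[OF S(1)] by blast
    have "\<forall>s\<in>S - T. c s = 0"
      using mx c(2) S(1) unfolding c(1) mS by (subst (asm) sum_nonneg_eq_0_iff) auto
    then have "x = (\<Sum>s\<in>T. c s *\<^sub>R s)"
      unfolding c(1) using S(1) T by (intro sum.mono_neutral_right) auto
    then show "x \<in> convex_cone hull T"
      unfolding convex_cone_hull_finite[OF finT] using c(2) T by blast
  qed
qed

text \<open>The relative interior of the cone if \<open>S\<close> is independent. The empty sum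
  makes \<open>open_cone {}\<close> the origin, which accounts for the zero cone.\<close>

definition open_cone :: "'v::real_vector set \<Rightarrow> 'v set" where
  "open_cone S = {\<Sum>s\<in>S. c s *\<^sub>R s | c. \<forall>s\<in>S. 0 < c s}"

lemma open_cone_subset: "finite S \<Longrightarrow> open_cone S \<subseteq> convex_cone hull S"
  unfolding open_cone_def convex_cone_hull_finite by (auto intro: less_imp_le)

lemma cone_hull_open_cones:
  assumes "finite S" "x \<in> convex_cone hull S"
  shows "\<exists>T\<subseteq>S. x \<in> open_cone T"
proof -
  obtain c where c: "x = (\<Sum>s\<in>S. c s *\<^sub>R s)" "\<forall>s\<in>S. 0 \<le> c s"
    using assms(2) unfolding convex_cone_hull_finite[OF assms(1)] by blast
  have "x = (\<Sum>s\<in>{s\<in>S. c s \<noteq> 0}. c s *\<^sub>R s)"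
    unfolding c(1) using assms(1) by (intro sum.mono_neutral_right) auto
  moreover have "\<forall>s\<in>{s\<in>S. c s \<noteq> 0}. 0 < c s" using c(2) by (auto simp: order_less_le)
  ultimately have "x \<in> open_cone {s\<in>S. c s \<noteq> 0}" unfolding open_cone_def by blast
  then show ?thesis by (intro exI[of _ "{s\<in>S. c s \<noteq> 0}"]) auto
qed

text \<open>If the open cones partition the space, a point common to two cones lies in one open cone
  spanned by shared generators. So the cones over \<open>S\<close> and \<open>T\<close> meet in the
  cone over \<open>S \<inter> T\<close>, a face of both.\<close>

theorem simplicial_fan:
  fixes N :: "'v::real_vector set"
  assumes N: "full_lattice r N" and K: "finite K"
    and basis: "\<And>S. S \<in> K \<Longrightarrow> \<exists>B. Z_basis B N \<and> S \<subseteq> B"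
    and subset: "\<And>S T. \<lbrakk>S \<in> K; T \<subseteq> S\<rbrakk> \<Longrightarrow> T \<in> K"
    and cover: "\<And>x. \<exists>S\<in>K. x \<in> open_cone S"
    and disjoint: "\<And>S T x. \<lbrakk>S \<in> K; T \<in> K; x \<in> open_cone S; x \<in> open_cone T\<rbrakk> \<Longrightarrow> S = T"
  shows "smooth_fan N ((hull) convex_cone ` K) \<and> complete_fan N ((hull) convex_cone ` K)"
proof -
  have fin: "finite S" and indep: "independent S" and sub: "S \<subseteq> N" if S: "S \<in> K" for S
  proof -
    obtain B where B: "Z_basis B N" "S \<subseteq> B" using basis[OF S] by blast
    show "finite S" "S \<subseteq> N"
      using B Z_basis_finite[OF B(1)] Z_basis_subset[OF B(1)] finite_subset by blast+
    show "independent S" using Z_basis_independent[OF N B(1)] B(2) by (rule independent_mono)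
  qed
  have int: "(convex_cone hull S) \<inter> (convex_cone hull T) = convex_cone hull (S \<inter> T)"
    if ST: "S \<in> K" "T \<in> K" for S T
  proof (intro equalityI subsetI)
    fix x assume "x \<in> (convex_cone hull S) \<inter> (convex_cone hull T)"
    then obtain S' T' where *: "S' \<subseteq> S" "x \<in> open_cone S'" "T' \<subseteq> T" "x \<in> open_cone T'"
      using cone_hull_open_cones fin ST by (metis IntD1 IntD2)
    then have "S' = T'" using ST by (intro disjoint[of _ _ x]) (auto intro: subset)
    then have "S' \<subseteq> S \<inter> T" using * by blast
    then have "convex_cone hull S' \<subseteq> convex_cone hull (S \<inter> T)" by (rule hull_mono)
    moreover have "x \<in> convex_cone hull S'"
      using open_cone_subset[of S'] *(1,2) fin[OF ST(1)] finite_subset by blast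
    ultimately show "x \<in> convex_cone hull (S \<inter> T)" by blast
  qed (use hull_mono[of "S \<inter> T" S] hull_mono[of "S \<inter> T" T] in blast)
  have "fan N ((hull) convex_cone ` K)"
    unfolding fan_def
  proof (intro conjI ballI allI impI)
    show "finite ((hull) convex_cone ` K)" using K by simp
  next
    fix \<sigma> assume "\<sigma> \<in> (hull) convex_cone ` K"
    then obtain S where S: "S \<in> K" "\<sigma> = convex_cone hull S" by blast
    show "rational_polyhedral_cone N \<sigma>"
      unfolding rational_polyhedral_cone_def using S fin sub by blast
    show "strongly_convex \<sigma>" unfolding S(2) using fin indep S(1) by (intro strongly_convex_cone_hull)
    fix \<tau> assume "cone_face \<tau> \<sigma>"
    then obtain T where "T \<subseteq> S" "\<tau> = convex_cone hull T"
      using face_of_cone_hull[OF fin[OF S(1)]] S(2) by blast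
    then show "\<tau> \<in> (hull) convex_cone ` K" using subset S(1) by blast
  next
    fix \<sigma> \<tau> assume "\<sigma> \<in> (hull) convex_cone ` K" "\<tau> \<in> (hull) convex_cone ` K"
    then obtain S T where S: "S \<in> K" "\<sigma> = convex_cone hull S" and T: "T \<in> K" "\<tau> = convex_cone hull T" by blast
    show "cone_face (\<sigma> \<inter> \<tau>) \<sigma>" "cone_face (\<sigma> \<inter> \<tau>) \<tau>"
      unfolding S(2) T(2) int[OF S(1) T(1)] using S(1) T(1) fin indep by (auto intro!: cone_face_subset)
  qed
  moreover have "x \<in> \<Union> ((hull) convex_cone ` K)" for x
    using cover[of x] open_cone_subset fin by blast
  ultimately show ?thesis
    unfolding smooth_fan_def complete_fan_def using basis by blast+
qed

subsection \<open>Plane fans given by their oriented maximal cones\<close>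

type_synonym ivec = "int \<times> int"

definition idet :: "ivec \<Rightarrow> ivec \<Rightarrow> int" where
  "idet u w = fst u * snd w - snd u * fst w"

text \<open>The star subdivision of one maximal cone at the sum of its generators. A pair that is
  not an edge has no effect, so every list of pairs describes an iterated blow-up.\<close>

fun blow_up :: "ivec \<times> ivec \<Rightarrow> (ivec \<times> ivec) list \<Rightarrow> (ivec \<times> ivec) list" where
  "blow_up (u, w) E = (if (u, w) \<in> set E
     then (u, u + w) # (u + w, w) # removeAll (u, w) E else E)"

definition square :: "(ivec \<times> ivec) list" where
  "square = [((1, 0), (0, 1)), ((0, 1), (-1, 0)), ((-1, 0), (0, -1)), ((0, -1), (1, 0))]"

text \<open>
  The linear map that sends the edge \<open>p\<close> to the edge \<open>q\<close>, by Cramer's rule if \<open>p\<close> has determinant 1.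
\<close>
definition base_change :: "ivec \<times> ivec \<Rightarrow> ivec \<times> ivec \<Rightarrow> ivec \<Rightarrow> ivec" where
  "base_change p q x = (idet x (snd p) * fst (fst q) + idet (fst p) x * fst (snd q),
     idet x (snd p) * snd (fst q) + idet (fst p) x * snd (snd q))"

text \<open>The candidate of determinant 1 is fixed by sending the first edge to \<open>q\<close>.
  Finiteness makes it enough that edges go to edges.\<close>

definition rotates :: "(ivec \<times> ivec) list \<Rightarrow> ivec \<times> ivec \<Rightarrow> bool" where
  "rotates E q \<longleftrightarrow> (\<forall>r\<in>set E. map_prod (base_change (hd E) q) (base_change (hd E) q) r \<in> set E)"

text \<open>Determinant -1 reverses orientation, so an edge must be swapped for its image to be an
  edge; likewise the first edge goes to \<open>q\<close> reversed.\<close>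

definition reflects :: "(ivec \<times> ivec) list \<Rightarrow> ivec \<times> ivec \<Rightarrow> bool" where
  "reflects E q \<longleftrightarrow> (\<forall>r\<in>set E.
     map_prod (base_change (hd E) (prod.swap q)) (base_change (hd E) (prod.swap q)) (prod.swap r) \<in> set E)"

definition symmetry_type :: "(ivec \<times> ivec) list \<Rightarrow> group_type" where
  "symmetry_type E = (let n = card (set (filter (rotates E) E)) in
     if list_ex (reflects E) E then Dihedral n else Cyclic n)"


section \<open>The standard lattice and determinants in the plane\<close>

definition of_ivec :: "ivec \<Rightarrow> real^2" where
  "of_ivec p = vector [of_int (fst p), of_int (snd p)]"

definition Z2 :: "(real^2) set" where
  "Z2 = range of_ivec"

definition rdet :: "real^2 \<Rightarrow> real^2 \<Rightarrow> real" where
  "rdet x y = x$1 * y$2 - x$2 * y$1"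

lemma of_ivec_nth [simp]: "of_ivec p $ 1 = of_int (fst p)" "of_ivec p $ 2 = of_int (snd p)"
  by (simp_all add: of_ivec_def)

lemma real2_eq_iff: "x = y \<longleftrightarrow> x$1 = y$1 \<and> x$2 = y$2" for x y :: "real^2"
  by (auto simp: vec_eq_iff forall_2)

lemma of_ivec_eq_iff: "of_ivec p = of_ivec q \<longleftrightarrow> p = q"
  by (auto simp: real2_eq_iff prod_eq_iff)

lemma rdet_of_ivec: "rdet (of_ivec p) (of_ivec q) = of_int (idet p q)"
  by (simp add: rdet_def idet_def)

lemma idet_neq: "idet u w = 1 \<Longrightarrow> u \<noteq> w"
  by (auto simp: idet_def)

text \<open>Cramer's rule with denominator 1. At lattice points the coefficients are values of
  \<open>idet\<close>, hence integers, so edges are lattice bases.\<close>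

lemma edge_coordinates:
  assumes "idet u w = 1"
  shows "x = rdet x (of_ivec w) *\<^sub>R of_ivec u + rdet (of_ivec u) x *\<^sub>R of_ivec w"
proof -
  define a b c d where "a = real_of_int (fst u)" and "b = real_of_int (snd u)"
    and "c = real_of_int (fst w)" and "d = real_of_int (snd w)"
  have e: "a * d - b * c = 1"
    using arg_cong[OF assms, of real_of_int] by (simp add: idet_def a_def b_def c_def d_def)
  have "(x$1 * d - x$2 * c) * a + (a * x$2 - b * x$1) * c = (a * d - b * c) * x$1"
    "(x$1 * d - x$2 * c) * b + (a * x$2 - b * x$1) * d = (a * d - b * c) * x$2"
    by (simp_all add: algebra_simps)
  then show ?thesis
    unfolding e by (simp add: real2_eq_iff rdet_def a_def b_def c_def d_def)
qed

lemma rdet_edge_combination: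
  assumes "idet u w = 1"
  shows "rdet (a *\<^sub>R of_ivec u + b *\<^sub>R of_ivec w) (of_ivec w) = a"
    and "rdet (of_ivec u) (a *\<^sub>R of_ivec u + b *\<^sub>R of_ivec w) = b"
proof -
  have e: "real_of_int (fst u) * real_of_int (snd w) - real_of_int (snd u) * real_of_int (fst w) = 1"
    using arg_cong[OF assms, of real_of_int] by (simp add: idet_def)
  have "rdet (a *\<^sub>R of_ivec u + b *\<^sub>R of_ivec w) (of_ivec w)
      = a * (real_of_int (fst u) * real_of_int (snd w) - real_of_int (snd u) * real_of_int (fst w))"
    "rdet (of_ivec u) (a *\<^sub>R of_ivec u + b *\<^sub>R of_ivec w)
      = b * (real_of_int (fst u) * real_of_int (snd w) - real_of_int (snd u) * real_of_int (fst w))"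
    by (simp_all add: rdet_def algebra_simps)
  then show "rdet (a *\<^sub>R of_ivec u + b *\<^sub>R of_ivec w) (of_ivec w) = a"
    "rdet (of_ivec u) (a *\<^sub>R of_ivec u + b *\<^sub>R of_ivec w) = b"
    unfolding e by simp_all
qed

lemma Z_basis_edge:
  assumes "idet u w = 1"
  shows "Z_basis {of_ivec u, of_ivec w} Z2"
proof -
  have ne: "of_ivec u \<noteq> of_ivec w" using idet_neq[OF assms] by (simp add: of_ivec_eq_iff)
  have comb: "of_int a *\<^sub>R of_ivec u + of_int b *\<^sub>R of_ivec w = of_ivec (a * fst u + b * fst w, a * snd u + b * snd w)" for a b
    by (simp add: real2_eq_iff)
  have "Z_span {of_ivec u, of_ivec w} = Z2"
    unfolding Z_span_def Z2_def
  proof (intro equalityI subsetI)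
    fix x assume "x \<in> range of_ivec"
    then obtain p where p: "x = of_ivec p" by blast
    have "x = (\<Sum>b\<in>{of_ivec u, of_ivec w}. of_int ((\<lambda>b. if b = of_ivec u then idet p w else idet u p) b) *\<^sub>R b)"
      using ne edge_coordinates[OF assms, of x] by (simp add: p rdet_of_ivec)
    then show "x \<in> range (\<lambda>c::real^2 \<Rightarrow> int. \<Sum>b\<in>{of_ivec u, of_ivec w}. of_int (c b) *\<^sub>R b)"
      by (rule range_eqI[where x = "\<lambda>b. if b = of_ivec u then idet p w else idet u p"])
  qed (use ne in \<open>auto simp: comb\<close>)
  moreover have "c (of_ivec u) = 0 \<and> c (of_ivec w) = 0"
    if "(\<Sum>b\<in>{of_ivec u, of_ivec w}. of_int (c b) *\<^sub>R b) = 0" for c :: "real^2 \<Rightarrow> int"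
  proof -
    have z: "of_int (c (of_ivec u)) *\<^sub>R of_ivec u + of_int (c (of_ivec w)) *\<^sub>R of_ivec w = 0" using that ne by simp
    have "rdet 0 (of_ivec w) = 0" "rdet (of_ivec u) 0 = 0" by (simp_all add: rdet_def)
    then show ?thesis
      using rdet_edge_combination[OF assms, of "of_int (c (of_ivec u))" "of_int (c (of_ivec w))"] unfolding z by simp
  qed
  ultimately show ?thesis by (simp add: Z_basis_def)
qed

lemma axis_of_ivec: "axis 1 1 = of_ivec (1, 0)" "axis 2 1 = of_ivec (0, 1)"
  by (simp_all add: real2_eq_iff axis_def)

lemma planar_lattice_Z2: "planar_lattice Z2 (\<lambda>i. axis i 1)"
proof
  have range: "range (\<lambda>i::2. axis i (1::real)) = {of_ivec (1, 0), of_ivec (0, 1)}"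
    unfolding UNIV_2 by (simp add: axis_of_ivec)
  show "Z_basis (range (\<lambda>i::2. axis i (1::real))) Z2"
    unfolding range by (rule Z_basis_edge) (simp add: idet_def)
  have Basis: "range (\<lambda>i::2. axis i (1::real)) = Basis"
    by (auto simp: Basis_vec_def)
  show "independent (range (\<lambda>i::2. axis i (1::real)))" "span (range (\<lambda>i::2. axis i (1::real))) = UNIV"
    unfolding Basis by (rule independent_Basis, rule span_Basis)
  show "inj (\<lambda>i::2. axis i (1::real))" by (auto simp: inj_def axis_eq_axis)
qed

interpretation Z2: planar_lattice Z2 "\<lambda>i. axis i 1"
  by (rule planar_lattice_Z2)

text \<open>
  The sector of an edge contains its first but not its second boundary ray, so that the sectors of
  the maximal cones of a complete fan partition the punctured plane.
\<close>
definition in_sector :: "ivec \<times> ivec \<Rightarrow> real^2 \<Rightarrow> bool" where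
  "in_sector p x \<longleftrightarrow> 0 < rdet x (of_ivec (snd p)) \<and> 0 \<le> rdet (of_ivec (fst p)) x"

text \<open>The middle condition makes every ray the first ray of some edge. This matches the
  half-open sectors, which contain only their first ray.\<close>

definition fan_edges :: "(ivec \<times> ivec) list \<Rightarrow> bool" where
  "fan_edges E \<longleftrightarrow> (\<forall>p\<in>set E. idet (fst p) (snd p) = 1) \<and> snd ` set E \<subseteq> fst ` set E \<and>
     (\<forall>x. x \<noteq> 0 \<longrightarrow> (\<exists>!p. p \<in> set E \<and> in_sector p x))"

lemma fan_edges_square: "fan_edges square"
proof -
  have "\<exists>!p. p \<in> set square \<and> in_sector p x" if "x \<noteq> 0" for x
  proof -
    have s: "in_sector ((1, 0), (0, 1)) x \<longleftrightarrow> 0 < x$1 \<and> 0 \<le> x$2"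
      "in_sector ((0, 1), (-1, 0)) x \<longleftrightarrow> 0 < x$2 \<and> x$1 \<le> 0"
      "in_sector ((-1, 0), (0, -1)) x \<longleftrightarrow> x$1 < 0 \<and> x$2 \<le> 0"
      "in_sector ((0, -1), (1, 0)) x \<longleftrightarrow> x$2 < 0 \<and> 0 \<le> x$1"
      by (simp_all add: in_sector_def rdet_def)
    have "x$1 \<noteq> 0 \<or> x$2 \<noteq> 0" using that by (simp add: real2_eq_iff)
    then consider "0 < x$1 \<and> 0 \<le> x$2" | "0 < x$2 \<and> x$1 \<le> 0" | "x$1 < 0 \<and> x$2 \<le> 0" | "x$2 < 0 \<and> 0 \<le> x$1"
      by linarith
    then show ?thesis
    proof cases
      case 1
      then show ?thesis by (intro ex1I[of _ "((1, 0), (0, 1))"]) (auto simp: square_def s)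
    next
      case 2
      then show ?thesis by (intro ex1I[of _ "((0, 1), (-1, 0))"]) (auto simp: square_def s)
    next
      case 3
      then show ?thesis by (intro ex1I[of _ "((-1, 0), (0, -1))"]) (auto simp: square_def s)
    next
      case 4
      then show ?thesis by (intro ex1I[of _ "((0, -1), (1, 0))"]) (auto simp: square_def s)
    qed
  qed
  then show ?thesis by (auto simp: fan_edges_def square_def idet_def)
qed

lemma idet_add: "idet u (u + w) = idet u w" "idet (u + w) w = idet u w"
  by (simp_all add: idet_def algebra_simps)

lemma of_ivec_add: "of_ivec (u + w) = of_ivec u + of_ivec w"
  by (simp add: real2_eq_iff)

lemma rdet_add: "rdet x (y + z) = rdet x y + rdet x z" "rdet (x + y) z = rdet x z + rdet y z"
  by (simp_all add: rdet_def algebra_simps)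

lemma rdet_swap: "rdet x y = - rdet y x"
  by (simp add: rdet_def)

text \<open>The ray through \<open>u + w\<close> cuts the sector of \<open>(u, w)\<close> into two,
  and all other sectors are unchanged.\<close>

lemma fan_edges_blow_up:
  assumes "fan_edges E"
  shows "fan_edges (blow_up p E)"
proof (cases "p \<in> set E")
  case True
  obtain u w where p: "p = (u, w)" by (cases p)
  let ?p = "(u, u + w)" and ?q = "(u + w, w)"
  have E: "\<And>p. p \<in> set E \<Longrightarrow> idet (fst p) (snd p) = 1" "snd ` set E \<subseteq> fst ` set E"
    and part: "\<And>x. x \<noteq> 0 \<Longrightarrow> \<exists>!p. p \<in> set E \<and> in_sector p x"
    using assms by (auto simp: fan_edges_def)
  have uw: "idet u w = 1" using E(1)[OF True] p by simp
  have new: "set (blow_up p E) = insert ?p (insert ?q (set E - {p}))"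
    using True by (simp add: p)
  \<comment> \<open>The pieces are told apart by comparing the two coordinates of \<open>x\<close>.
    Equality puts \<open>x\<close> on the new ray, the first ray of \<open>?q\<close>.\<close>
  have split: "in_sector ?p x \<longleftrightarrow> in_sector p x \<and> rdet (of_ivec u) x < rdet x (of_ivec w)"
    "in_sector ?q x \<longleftrightarrow> in_sector p x \<and> \<not> rdet (of_ivec u) x < rdet x (of_ivec w)" for x
    using rdet_swap[of x "of_ivec u"] rdet_swap[of "of_ivec w" x]
    by (auto simp: in_sector_def p of_ivec_add rdet_add)
  have "\<exists>!q. q \<in> set (blow_up p E) \<and> in_sector q x" if nz: "x \<noteq> 0" for x
    using part[OF nz]
  proof (elim ex1E conjE)
    fix r assume r: "r \<in> set E" "in_sector r x" "\<forall>q. q \<in> set E \<and> in_sector q x \<longrightarrow> q = r"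
    have notin: "\<not> in_sector q x" if "q \<in> set E" "q \<noteq> r" for q
      using r(3) that by blast
    show ?thesis
    proof (cases "r = p")
      case True
      note in_p = r(2)[unfolded True] and notin = notin[unfolded True]
      show ?thesis
      proof (cases "rdet (of_ivec u) x < rdet x (of_ivec w)")
        case True
        then show ?thesis unfolding new using split[of x] in_p notin by (intro ex1I[of _ ?p]) auto
      next
        case False
        then show ?thesis unfolding new using split[of x] in_p notin by (intro ex1I[of _ ?q]) auto
      qed
    next
      case False
      then have "\<not> in_sector p x" using notin True by simp
      then show ?thesis unfolding new using split[of x] r(1,2) notin False by (intro ex1I[of _ r]) auto
    qed
  qed
  moreover have "snd ` set (blow_up p E) \<subseteq> fst ` set (blow_up p E)"
  proof -
    have "fst ` set E \<subseteq> fst ` set (blow_up p E)" unfolding new by (auto simp: p)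
    moreover have "w \<in> fst ` set E" using E(2) True p by force
    ultimately show ?thesis using E(2) unfolding new by auto
  qed
  moreover have "\<forall>q\<in>set (blow_up p E). idet (fst q) (snd q) = 1"
    unfolding new using E(1) uw by (auto simp: idet_add)
  ultimately show ?thesis unfolding fan_edges_def by blast
next
  case False
  then have "blow_up p E = E" by (cases p) simp
  with assms show ?thesis by simp
qed

lemma fan_edges_fold_blow_up: "fan_edges E \<Longrightarrow> fan_edges (fold blow_up ps E)"
  by (induction ps arbitrary: E) (auto intro: fan_edges_blow_up)

section \<open>The smooth complete fan given by a list of edges\<close>

definition edge_sets :: "(ivec \<times> ivec) list \<Rightarrow> (real^2) set set" where
  "edge_sets E = {S. \<exists>p\<in>set E. S \<subseteq> {of_ivec (fst p), of_ivec (snd p)}}"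

definition edge_fan :: "(ivec \<times> ivec) list \<Rightarrow> (real^2) set set" where
  "edge_fan E = (hull) convex_cone ` edge_sets E"

lemma open_cone_edge:
  assumes "idet u w = 1"
  shows "x \<in> open_cone {of_ivec u} \<longleftrightarrow> 0 < rdet x (of_ivec w) \<and> rdet (of_ivec u) x = 0"
    and "x \<in> open_cone {of_ivec u, of_ivec w} \<longleftrightarrow> 0 < rdet x (of_ivec w) \<and> 0 < rdet (of_ivec u) x"
proof -
  note x = edge_coordinates[OF assms, of x]
  have ne: "of_ivec u \<noteq> of_ivec w" using idet_neq[OF assms] by (simp add: of_ivec_eq_iff)
  show "x \<in> open_cone {of_ivec u} \<longleftrightarrow> 0 < rdet x (of_ivec w) \<and> rdet (of_ivec u) x = 0"
  proof
    assume "x \<in> open_cone {of_ivec u}"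
    then obtain c where "x = c *\<^sub>R of_ivec u + 0 *\<^sub>R of_ivec w" "0 < c" by (auto simp: open_cone_def)
    then show "0 < rdet x (of_ivec w) \<and> rdet (of_ivec u) x = 0" by (simp only: rdet_edge_combination[OF assms])
  next
    assume "0 < rdet x (of_ivec w) \<and> rdet (of_ivec u) x = 0"
    then show "x \<in> open_cone {of_ivec u}"
      using x unfolding open_cone_def by (intro CollectI exI[of _ "\<lambda>_. rdet x (of_ivec w)"]) simp
  qed
  show "x \<in> open_cone {of_ivec u, of_ivec w} \<longleftrightarrow> 0 < rdet x (of_ivec w) \<and> 0 < rdet (of_ivec u) x"
  proof
    assume "x \<in> open_cone {of_ivec u, of_ivec w}"
    then obtain c d where "x = c *\<^sub>R of_ivec u + d *\<^sub>R of_ivec w" "0 < c" "0 < d" using ne by (auto simp: open_cone_def)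
    then show "0 < rdet x (of_ivec w) \<and> 0 < rdet (of_ivec u) x" by (simp only: rdet_edge_combination[OF assms])
  next
    assume "0 < rdet x (of_ivec w) \<and> 0 < rdet (of_ivec u) x"
    then show "x \<in> open_cone {of_ivec u, of_ivec w}"
      using x ne unfolding open_cone_def
      by (intro CollectI exI[of _ "\<lambda>v. if v = of_ivec u then rdet x (of_ivec w) else rdet (of_ivec u) x"]) auto
  qed
qed

lemma subset_doubletonD: "S \<subseteq> {a, b} \<Longrightarrow> S = {} \<or> S = {a} \<or> S = {b} \<or> S = {a, b}"
  by (cases "a \<in> S"; cases "b \<in> S") auto

text \<open>A second ray is the first ray of another edge, so rays need to be treated only as first
  rays.\<close>

lemma edge_sets_cases:
  assumes "fan_edges E" "S \<in> edge_sets E"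
  obtains "S = {}" | p where "p \<in> set E" "S = {of_ivec (fst p)}"
    | p where "p \<in> set E" "S = {of_ivec (fst p), of_ivec (snd p)}"
proof -
  obtain p where p: "p \<in> set E" "S \<subseteq> {of_ivec (fst p), of_ivec (snd p)}"
    using assms(2) by (auto simp: edge_sets_def)
  from subset_doubletonD[OF this(2)]
  consider "S = {}" | "S = {of_ivec (fst p)}" | "S = {of_ivec (snd p)}" | "S = {of_ivec (fst p), of_ivec (snd p)}"
    by argo
  then show ?thesis
  proof cases
    case 1
    then show ?thesis by (rule that(1))
  next
    case 2
    with p(1) show ?thesis by (rule that(2))
  next
    case 3
    have "snd p \<in> fst ` set E" using assms(1) p(1) unfolding fan_edges_def by blast
    then obtain q where "q \<in> set E" "snd p = fst q" by blast
    with 3 show ?thesis by (intro that(2)[of q]) simp_all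
  next
    case 4
    with p(1) show ?thesis by (rule that(3))
  qed
qed

text \<open>The sector containing \<open>x\<close> determines the generators of the open cone around
  \<open>x\<close>. Uniqueness of sectors thus becomes disjointness of open cones.\<close>

lemma edge_set_of_point:
  assumes E: "fan_edges E" and S: "S \<in> edge_sets E" "x \<in> open_cone S" "x \<noteq> 0"
  obtains p where "p \<in> set E" "in_sector p x"
    "S = (if rdet (of_ivec (fst p)) x = 0 then {of_ivec (fst p)} else {of_ivec (fst p), of_ivec (snd p)})"
proof -
  have det: "idet (fst p) (snd p) = 1" if "p \<in> set E" for p
    using E that by (simp add: fan_edges_def)
  show ?thesis using E S(1)
  proof (cases rule: edge_sets_cases)
    case 1
    with S(2,3) show ?thesis by (simp add: open_cone_def)
  next
    case (2 p)
    with S(2) open_cone_edge(1)[OF det] show ?thesis by (intro that[of p]) (auto simp: in_sector_def)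
  next
    case (3 p)
    with S(2) open_cone_edge(2)[OF det] show ?thesis by (intro that[of p]) (auto simp: in_sector_def)
  qed
qed

lemma zero_open_cone:
  assumes "fan_edges E" "S \<in> edge_sets E" "0 \<in> open_cone S"
  shows "S = {}"
proof -
  have det: "idet (fst p) (snd p) = 1" if "p \<in> set E" for p
    using assms(1) that by (simp add: fan_edges_def)
  have 0: "rdet 0 y = 0" for y by (simp add: rdet_def)
  show ?thesis using assms(1,2)
  proof (cases rule: edge_sets_cases)
    case (2 p)
    then show ?thesis using assms(3) open_cone_edge(1)[OF det, of p] by (simp add: 0)
  next
    case (3 p)
    then show ?thesis using assms(3) open_cone_edge(2)[OF det, of p] by (simp add: 0)
  qed
qed

lemma fan_edges_nonempty: "fan_edges E \<Longrightarrow> E \<noteq> []"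
  unfolding fan_edges_def using axis_eq_0_iff[of 1 "1::real"] by (metis emptyE list.set(1) zero_neq_one)

lemma smooth_complete_edge_fan:
  assumes E: "fan_edges E"
  shows "smooth_fan Z2 (edge_fan E)" "complete_fan Z2 (edge_fan E)"
proof -
  have det: "idet (fst p) (snd p) = 1" if "p \<in> set E" for p
    using E that by (simp add: fan_edges_def)
  have "finite (edge_sets E)"
    by (rule finite_subset[of _ "\<Union>p\<in>set E. Pow {of_ivec (fst p), of_ivec (snd p)}"]) (auto simp: edge_sets_def)
  moreover have "\<exists>B. Z_basis B Z2 \<and> S \<subseteq> B" if "S \<in> edge_sets E" for S
    using that Z_basis_edge det unfolding edge_sets_def by blast
  moreover have "T \<in> edge_sets E" if "S \<in> edge_sets E" "T \<subseteq> S" for S T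
    using that unfolding edge_sets_def by blast
  moreover have "\<exists>S\<in>edge_sets E. x \<in> open_cone S" for x
  proof (cases "x = 0")
    case True
    have "{} \<in> edge_sets E" using fan_edges_nonempty[OF E] last_in_set unfolding edge_sets_def by blast
    moreover have "x \<in> open_cone {}" using True by (simp add: open_cone_def)
    ultimately show ?thesis by blast
  next
    case False
    then obtain p where p: "p \<in> set E" "in_sector p x" using E unfolding fan_edges_def by blast
    then have "x \<in> open_cone {of_ivec (fst p)} \<or> x \<in> open_cone {of_ivec (fst p), of_ivec (snd p)}"
      unfolding open_cone_edge[OF det[OF p(1)]] in_sector_def by auto
    moreover have "{of_ivec (fst p)} \<in> edge_sets E" "{of_ivec (fst p), of_ivec (snd p)} \<in> edge_sets E"
      using p(1) by (auto simp: edge_sets_def)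
    ultimately show ?thesis by blast
  qed
  moreover have "S = T" if ST: "S \<in> edge_sets E" "T \<in> edge_sets E" "x \<in> open_cone S" "x \<in> open_cone T" for S T x
  proof (cases "x = 0")
    case True
    then show ?thesis using zero_open_cone[OF E] ST by blast
  next
    case False
    obtain p where p: "p \<in> set E" "in_sector p x"
      "S = (if rdet (of_ivec (fst p)) x = 0 then {of_ivec (fst p)} else {of_ivec (fst p), of_ivec (snd p)})"
      using edge_set_of_point[OF E ST(1,3) False] .
    obtain q where q: "q \<in> set E" "in_sector q x"
      "T = (if rdet (of_ivec (fst q)) x = 0 then {of_ivec (fst q)} else {of_ivec (fst q), of_ivec (snd q)})"
      using edge_set_of_point[OF E ST(2,4) False] .
    have "p = q" using E p(1,2) q(1,2) False unfolding fan_edges_def by blast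
    then show ?thesis using p(3) q(3) by simp
  qed
  ultimately have "smooth_fan Z2 (edge_fan E) \<and> complete_fan Z2 (edge_fan E)"
    unfolding edge_fan_def by (rule simplicial_fan[OF Z2.lattice])
  then show "smooth_fan Z2 (edge_fan E)" "complete_fan Z2 (edge_fan E)" by simp_all
qed

subsection \<open>Automorphisms of plane fans\<close>

definition act :: "int^2^2 \<Rightarrow> ivec \<Rightarrow> ivec" where
  "act A x = (A$1$1 * fst x + A$1$2 * snd x, A$2$1 * fst x + A$2$2 * snd x)"

definition mat_map :: "int^2^2 \<Rightarrow> real^2 \<Rightarrow> real^2" where
  "mat_map A x = vector [of_int (A$1$1) * x$1 + of_int (A$1$2) * x$2,
     of_int (A$2$1) * x$1 + of_int (A$2$2) * x$2]"

lemma mat_map_nth [simp]: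
  "mat_map A x $ 1 = of_int (A$1$1) * x$1 + of_int (A$1$2) * x$2"
  "mat_map A x $ 2 = of_int (A$2$1) * x$1 + of_int (A$2$2) * x$2"
  by (simp_all add: mat_map_def)

lemma linear_mat_map: "linear (mat_map A)"
  by (rule linearI) (simp_all add: real2_eq_iff algebra_simps)

lemma mat_map_of_ivec: "mat_map A (of_ivec p) = of_ivec (act A p)"
  by (simp add: real2_eq_iff act_def)

lemma idet_act: "idet (act A x) (act A y) = det A * idet x y"
  by (simp add: idet_def act_def det_2 algebra_simps)

lemma act_inj:
  assumes "act A = act B"
  shows "A = B"
  using fun_cong[OF assms, of "(1, 0)"] fun_cong[OF assms, of "(0, 1)"]
  by (simp add: act_def mat2_eq_iff)

lemma Z2_coordinates: "of_ivec p = (\<Sum>i\<in>UNIV. of_int (if i = 1 then fst p else snd p) *\<^sub>R axis i 1)"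
  by (simp add: sum_2 real2_eq_iff axis_def)

lemma lin_eq_mat_map:
  assumes "g \<in> carrier (GL_Z Z2)"
  shows "Z2.lin g = mat_map (Z2.rep g)"
proof (rule Z2.lin_unique)
  fix x assume "x \<in> Z2"
  then obtain p where p: "x = of_ivec p" by (auto simp: Z2_def)
  have "g x = (\<Sum>i\<in>UNIV. of_int (if i = 1 then fst p else snd p) *\<^sub>R g (axis i 1))"
    unfolding p Z2_coordinates by (rule Z2.GL_linear_combination[OF assms])
  then show "mat_map (Z2.rep g) x = g x"
    unfolding Z2.rep_eq[OF assms] p by (simp add: sum_2 real2_eq_iff axis_def algebra_simps)
qed (rule linear_mat_map)

lemma lin_of_ivec: "g \<in> carrier (GL_Z Z2) \<Longrightarrow> Z2.lin g (of_ivec p) = of_ivec (act (Z2.rep g) p)"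
  by (simp add: lin_eq_mat_map mat_map_of_ivec)

lemma GL_of_matrix:
  assumes "det A = 1 \<or> det A = -1"
  obtains g where "g \<in> carrier (GL_Z Z2)" "Z2.rep g = A"
proof
  define a b c d where "a = A$1$1" and "b = A$1$2" and "c = A$2$1" and "d = A$2$2"
  \<comment> \<open>The determinant, 1 or -1 and so its own inverse: \<open>k\<close> times the
    adjugate inverts \<open>A\<close> over the integers.\<close>
  define k where "k = a * d - b * c"
  have k: "k * k = 1" using assms by (auto simp: det_2 k_def a_def b_def c_def d_def)
  have k': "real_of_int k * real_of_int k = 1" using k by (metis of_int_1 of_int_mult)
  define B :: "int^2^2" where "B = vector [vector [k * d, - k * b], vector [- k * c, k * a]]"
  have B: "B$1$1 = k * d" "B$1$2 = - k * b" "B$2$1 = - k * c" "B$2$2 = k * a"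
    by (simp_all add: B_def)
  have comp: "mat_map A (mat_map B x) = x" "mat_map B (mat_map A x) = x" for x
  proof -
    have "mat_map A (mat_map B x) = (of_int k * of_int k) *\<^sub>R x" "mat_map B (mat_map A x) = (of_int k * of_int k) *\<^sub>R x"
      by (simp_all add: real2_eq_iff B flip: a_def b_def c_def d_def) (simp_all add: k_def algebra_simps)
    then show "mat_map A (mat_map B x) = x" "mat_map B (mat_map A x) = x" by (simp_all add: k')
  qed
  have closed: "mat_map C x \<in> Z2" if "x \<in> Z2" for C x
    using that by (auto simp: Z2_def mat_map_of_ivec)
  let ?g = "restrict (mat_map A) Z2"
  have "bij_betw ?g Z2 Z2"
    by (rule bij_betw_byWitness[where f' = "mat_map B"]) (auto simp: comp closed)
  then show "?g \<in> carrier (GL_Z Z2)"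
    unfolding Z2.GL_carrier using Z_basis_add[OF Z2.basis] by (auto simp: linear_add[OF linear_mat_map])
  show "Z2.rep ?g = A"
  proof (rule Z2.rep_unique)
    fix j show "?g (axis j 1) = (\<Sum>i\<in>UNIV. of_int (A$i$j) *\<^sub>R axis i 1)"
      using exhaust_2[of j] Z2.basis_mem[of j] by (auto simp: sum_2 real2_eq_iff axis_def)
  qed
qed

text \<open>Passing to indecomposables turns the action on cones into an action on sets of
  generators.\<close>

lemma fan_aut_edge_sets:
  assumes E: "fan_edges E" and S: "S \<in> edge_sets E" and g: "g \<in> carrier (fan_aut Z2 (edge_fan E))"
  shows "Z2.lin g ` S \<in> edge_sets E"
proof -
  have basis: "indecomposables Z2 (convex_cone hull S) = S" if S: "S \<in> edge_sets E" for S
  proof -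
    obtain p where "p \<in> set E" "S \<subseteq> {of_ivec (fst p), of_ivec (snd p)}"
      using S by (auto simp: edge_sets_def)
    with E show ?thesis
      by (intro indecomposables_cone[OF Z2.lattice Z_basis_edge]) (auto simp: fan_edges_def)
  qed
  have "convex_cone hull S \<in> edge_fan E" using S by (simp add: edge_fan_def)
  moreover have "bij_betw ((`) (Z2.lin g)) (edge_fan E) (edge_fan E)" using g Z2.fan_aut_carrier by blast
  ultimately have "Z2.lin g ` (convex_cone hull S) \<in> edge_fan E" by (auto dest: bij_betwE)
  then obtain T where T: "T \<in> edge_sets E" "Z2.lin g ` (convex_cone hull S) = convex_cone hull T"
    by (auto simp: edge_fan_def)
  have "Z2.lin g ` S = T"
    using Z2.fan_aut_indecomposables[OF g, of "convex_cone hull S"] unfolding T(2) basis[OF S] basis[OF T(1)] ..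
  with T(1) show ?thesis by simp
qed

text \<open>An injective self-map of a finite fan is bijective, so mapping cones into the fan
  suffices.\<close>

lemma fan_aut_edge_fanI:
  assumes E: "fan_edges E" and g: "g \<in> carrier (GL_Z Z2)"
    and sets: "\<And>S. S \<in> edge_sets E \<Longrightarrow> Z2.lin g ` S \<in> edge_sets E"
  shows "g \<in> carrier (fan_aut Z2 (edge_fan E))"
proof -
  have "Z2.lin g ` \<sigma> \<in> edge_fan E" if "\<sigma> \<in> edge_fan E" for \<sigma>
    using that sets by (auto simp: edge_fan_def convex_cone_hull_linear_image[OF Z2.linear_lin[OF g], symmetric])
  moreover have "finite (edge_fan E)"
    using smooth_complete_edge_fan[OF E] by (simp add: smooth_fan_def fan_def)
  moreover have "inj_on ((`) (Z2.lin g)) (edge_fan E)"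
    using Z2.inj_lin[OF g] by (metis inj_image_eq_iff inj_onI)
  ultimately have "bij_betw ((`) (Z2.lin g)) (edge_fan E) (edge_fan E)"
    by (intro bij_betw_imageI endo_inj_surj) auto
  with g show ?thesis by (simp add: Z2.fan_aut_carrier)
qed

lemma fan_aut_edge_fan_iff:
  assumes E: "fan_edges E" and g: "g \<in> carrier (GL_Z Z2)"
  defines "f \<equiv> act (Z2.rep g)"
  shows "g \<in> carrier (fan_aut Z2 (edge_fan E)) \<longleftrightarrow>
    (\<forall>p\<in>set E. map_prod f f p \<in> set E \<or> map_prod f f (prod.swap p) \<in> set E)"
proof
  assume aut: "g \<in> carrier (fan_aut Z2 (edge_fan E))"
  show "\<forall>p\<in>set E. map_prod f f p \<in> set E \<or> map_prod f f (prod.swap p) \<in> set E"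
  proof
    fix p assume p: "p \<in> set E"
    then have "{of_ivec (fst p), of_ivec (snd p)} \<in> edge_sets E" by (auto simp: edge_sets_def)
    from fan_aut_edge_sets[OF E this aut]
    have "{of_ivec (f (fst p)), of_ivec (f (snd p))} \<in> edge_sets E" by (simp add: lin_of_ivec[OF g] f_def)
    then obtain q where q: "q \<in> set E" "{of_ivec (f (fst p)), of_ivec (f (snd p))} \<subseteq> {of_ivec (fst q), of_ivec (snd q)}"
      by (auto simp: edge_sets_def)
    \<comment> \<open>Distinct images exhaust the edge \<open>q\<close>, leaving only the order of
      its two rays open.\<close>
    have "Z2.lin g (of_ivec (fst p)) \<noteq> Z2.lin g (of_ivec (snd p))"
      using E p Z2.inj_lin[OF g] idet_neq by (auto simp: fan_edges_def inj_eq of_ivec_eq_iff)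
    then have "f (fst p) \<noteq> f (snd p)" by (simp add: lin_of_ivec[OF g] of_ivec_eq_iff f_def)
    with q(2) have "map_prod f f p = q \<or> map_prod f f (prod.swap p) = q"
      by (auto simp: of_ivec_eq_iff prod_eq_iff)
    with q(1) show "map_prod f f p \<in> set E \<or> map_prod f f (prod.swap p) \<in> set E" by blast
  qed
next
  assume *: "\<forall>p\<in>set E. map_prod f f p \<in> set E \<or> map_prod f f (prod.swap p) \<in> set E"
  show "g \<in> carrier (fan_aut Z2 (edge_fan E))"
  proof (rule fan_aut_edge_fanI[OF E g])
    fix S assume "S \<in> edge_sets E"
    then obtain p where p: "p \<in> set E" "S \<subseteq> {of_ivec (fst p), of_ivec (snd p)}" by (auto simp: edge_sets_def)
    have "Z2.lin g ` S \<subseteq> {of_ivec (f (fst p)), of_ivec (f (snd p))}"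
      using p(2) by (auto simp: lin_of_ivec[OF g] f_def)
    moreover have "map_prod f f p \<in> set E \<or> map_prod f f (prod.swap p) \<in> set E" using * p(1) by blast
    ultimately show "Z2.lin g ` S \<in> edge_sets E"
      unfolding edge_sets_def by (force simp: insert_commute)
  qed
qed

lemma base_change_fst: "idet (fst p) (snd p) = 1 \<Longrightarrow> base_change p q (fst p) = fst q"
  and base_change_snd: "idet (fst p) (snd p) = 1 \<Longrightarrow> base_change p q (snd p) = snd q"
  by (simp_all add: base_change_def) (simp_all add: idet_def)

text \<open>A linear map is recovered from the image of a single edge, since an edge is a
  basis.\<close>

lemma base_change_act:
  assumes "idet (fst p) (snd p) = 1"
  shows "base_change p (map_prod (act A) (act A) p) = act A"
proof
  fix x :: ivec
  obtain a b c d where p: "p = ((a, b), (c, d))" by (metis surj_pair)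
  obtain y z where x: "x = (y, z)" by (metis surj_pair)
  have e: "a * d - b * c = 1" using assms by (simp add: p idet_def)
  have "(y * d - z * c) * (k * a + l * b) + (a * z - b * y) * (k * c + l * d) = (a * d - b * c) * (k * y + l * z)" for k l
    by (simp add: algebra_simps)
  then show "base_change p (map_prod (act A) (act A) p) x = act A x"
    unfolding e by (simp add: p x base_change_def act_def idet_def)
qed

text \<open>\<open>base_change p q\<close> is the matrix with columns \<open>q\<close> times the
  adjugate of the one with columns \<open>p\<close>; this gives the product of determinants.\<close>

lemma base_change_matrix:
  obtains A where "act A = base_change p q" "det A = idet (fst p) (snd p) * idet (fst q) (snd q)"
proof
  define A :: "int^2^2" where "A = vector
    [vector [fst (base_change p q (1, 0)), fst (base_change p q (0, 1))],
     vector [snd (base_change p q (1, 0)), snd (base_change p q (0, 1))]]"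
  have A: "A$1$1 = fst (base_change p q (1, 0))" "A$1$2 = fst (base_change p q (0, 1))"
    "A$2$1 = snd (base_change p q (1, 0))" "A$2$2 = snd (base_change p q (0, 1))"
    by (simp_all add: A_def)
  show "act A = base_change p q"
    by (simp add: fun_eq_iff act_def A base_change_def idet_def algebra_simps)
  show "det A = idet (fst p) (snd p) * idet (fst q) (snd q)"
    by (simp add: det_2 A base_change_def idet_def algebra_simps)
qed

lemma swap_idet: "idet w u = - idet u w"
  by (simp add: idet_def)

text \<open>Determinant 1 preserves \<open>idet\<close>, which is 1 on edges and would be -1 on a
  reversed image.\<close>

lemma fan_aut_rotation_iff:
  assumes E: "fan_edges E" and g: "g \<in> carrier (GL_Z Z2)" and det: "det (Z2.rep g) = 1"
  defines "f \<equiv> act (Z2.rep g)"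
  shows "g \<in> carrier (fan_aut Z2 (edge_fan E)) \<longleftrightarrow> (\<forall>p\<in>set E. map_prod f f p \<in> set E)"
proof -
  have "map_prod f f (prod.swap p) \<notin> set E" if "p \<in> set E" for p
  proof
    assume "map_prod f f (prod.swap p) \<in> set E"
    then have "idet (f (snd p)) (f (fst p)) = 1" using E by (force simp: fan_edges_def)
    then show False using E that det swap_idet[of "snd p" "fst p"] by (simp add: f_def idet_act fan_edges_def)
  qed
  then show ?thesis unfolding fan_aut_edge_fan_iff[OF E g] f_def by blast
qed

lemma fan_aut_reflection_iff:
  assumes E: "fan_edges E" and g: "g \<in> carrier (GL_Z Z2)" and det: "det (Z2.rep g) = -1"
  defines "f \<equiv> act (Z2.rep g)"
  shows "g \<in> carrier (fan_aut Z2 (edge_fan E)) \<longleftrightarrow> (\<forall>p\<in>set E. map_prod f f (prod.swap p) \<in> set E)"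
proof -
  have "map_prod f f p \<notin> set E" if "p \<in> set E" for p
  proof
    assume "map_prod f f p \<in> set E"
    then have "idet (f (fst p)) (f (snd p)) = 1" using E by (force simp: fan_edges_def)
    then show False using E that det by (simp add: f_def idet_act fan_edges_def)
  qed
  then show ?thesis unfolding fan_aut_edge_fan_iff[OF E g] f_def by blast
qed

text \<open>Evaluation at the first edge is a bijection from the automorphisms of determinant 1 onto
  the edges passing the test, with inverse given by \<open>base_change\<close>.\<close>

lemma card_edge_fan_rotations:
  assumes E: "fan_edges E"
  shows "card {g \<in> carrier (fan_aut Z2 (edge_fan E)). det (Z2.rep g) = 1} = card (set (filter (rotates E) E))"
proof -
  let ?p = "hd E"
  have p: "?p \<in> set E" using fan_edges_nonempty[OF E] by simp
  have det: "idet (fst q) (snd q) = 1" if "q \<in> set E" for q using E that by (simp add: fan_edges_def)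
  let ?h = "\<lambda>g. map_prod (act (Z2.rep g)) (act (Z2.rep g)) ?p"
  let ?R = "{g \<in> carrier (fan_aut Z2 (edge_fan E)). det (Z2.rep g) = 1}"
  have GL: "g \<in> carrier (GL_Z Z2)" if "g \<in> ?R" for g using that Z2.fan_aut_carrier by blast
  have bc: "base_change ?p (?h g) = act (Z2.rep g)" for g using base_change_act[OF det[OF p]] .
  have "bij_betw ?h ?R (set (filter (rotates E) E))"
    unfolding bij_betw_def
  proof (intro conjI inj_onI equalityI subsetI)
    fix g h assume gh: "g \<in> ?R" "h \<in> ?R" "?h g = ?h h"
    have "act (Z2.rep g) = act (Z2.rep h)" using arg_cong[OF gh(3), of "base_change ?p"] unfolding bc .
    then have "Z2.rep g = Z2.rep h" by (rule act_inj)
    then show "g = h" using gh(1,2) GL by (intro inj_onD[OF Z2.rep_inj]) auto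
  next
    fix q assume "q \<in> ?h ` ?R"
    then obtain g where g: "g \<in> ?R" "q = ?h g" by blast
    then have "\<forall>r\<in>set E. map_prod (act (Z2.rep g)) (act (Z2.rep g)) r \<in> set E"
      using fan_aut_rotation_iff[OF E GL[OF g(1)]] by blast
    then show "q \<in> set (filter (rotates E) E)"
      using p unfolding g(2) by (simp add: rotates_def bc)
  next
    fix q assume "q \<in> set (filter (rotates E) E)"
    then have q: "q \<in> set E" "rotates E q" by auto
    obtain A where A: "act A = base_change ?p q" "det A = idet (fst ?p) (snd ?p) * idet (fst q) (snd q)"
      by (rule base_change_matrix)
    then have "det A = 1" using det p q by simp
    then obtain g where g: "g \<in> carrier (GL_Z Z2)" "Z2.rep g = A" using GL_of_matrix by blast
    have "g \<in> ?R"
      using q(2) fan_aut_rotation_iff[OF E g(1)] \<open>det A = 1\<close> unfolding g(2) A(1) rotates_def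
      by (simp add: g(2))
    moreover have "?h g = q"
      unfolding g(2) A(1) using base_change_fst[OF det[OF p]] base_change_snd[OF det[OF p]] by (simp add: prod_eq_iff)
    ultimately show "q \<in> ?h ` ?R" by blast
  qed
  then show ?thesis by (rule bij_betw_same_card)
qed

lemma edge_fan_reflection_iff:
  assumes E: "fan_edges E"
  shows "(\<exists>g\<in>carrier (fan_aut Z2 (edge_fan E)). det (Z2.rep g) = -1) \<longleftrightarrow> list_ex (reflects E) E"
proof
  let ?p = "hd E"
  have p: "?p \<in> set E" using fan_edges_nonempty[OF E] by simp
  have det: "idet (fst q) (snd q) = 1" if "q \<in> set E" for q using E that by (simp add: fan_edges_def)
  {
    assume "\<exists>g\<in>carrier (fan_aut Z2 (edge_fan E)). det (Z2.rep g) = -1"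
    then obtain g where g: "g \<in> carrier (fan_aut Z2 (edge_fan E))" "det (Z2.rep g) = -1" by blast
    let ?f = "act (Z2.rep g)"
    have gG: "g \<in> carrier (GL_Z Z2)" using g(1) Z2.fan_aut_carrier by blast
    have *: "\<forall>r\<in>set E. map_prod ?f ?f (prod.swap r) \<in> set E"
      using fan_aut_reflection_iff[OF E gG g(2)] g(1) by blast
    \<comment> \<open>The image of the first edge is a reversed edge; \<open>?q\<close> is that edge
      in its proper order.\<close>
    let ?q = "map_prod ?f ?f (prod.swap ?p)"
    have "prod.swap ?q = map_prod ?f ?f ?p" by (simp add: prod_eq_iff)
    then have "base_change ?p (prod.swap ?q) = ?f" using base_change_act[OF det[OF p]] by simp
    then have "reflects E ?q" using * by (simp add: reflects_def)
    with * p show "list_ex (reflects E) E" by (auto simp: list_ex_iff)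
  next
    assume "list_ex (reflects E) E"
    then obtain q where q: "q \<in> set E" "reflects E q" by (auto simp: list_ex_iff)
    obtain A where A: "act A = base_change ?p (prod.swap q)"
      "det A = idet (fst ?p) (snd ?p) * idet (fst (prod.swap q)) (snd (prod.swap q))"
      by (rule base_change_matrix)
    then have "det A = -1" using det[OF p] det[OF q(1)] swap_idet[of "snd q" "fst q"] by simp
    then obtain g where g: "g \<in> carrier (GL_Z Z2)" "Z2.rep g = A" using GL_of_matrix by blast
    have "g \<in> carrier (fan_aut Z2 (edge_fan E))"
      using q(2) fan_aut_reflection_iff[OF E g(1)] \<open>det A = -1\<close> unfolding g(2) A(1) reflects_def by blast
    with g(2) \<open>det A = -1\<close> show "\<exists>g\<in>carrier (fan_aut Z2 (edge_fan E)). det (Z2.rep g) = -1" by blast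
  }
qed

text \<open>Turns the automorphism group of a concrete fan into an evaluation of
  \<open>symmetry_type\<close>.\<close>

theorem edge_fan_type:
  assumes E: "fan_edges E"
  shows "fan_aut_has_type Z2 (edge_fan E) (symmetry_type E)"
  using Z2.fan_aut_type(2,3)[OF smooth_complete_edge_fan[OF E]] edge_fan_reflection_iff[OF E]
  unfolding card_edge_fan_rotations[OF E] symmetry_type_def by (auto simp: Let_def)

text \<open>
  If \<open>v\<^sub>1, \<dots>, v\<^sub>n\<close> are the rays of a complete smooth fan in cyclic order, then
  \<open>v\<^bsub>i-1\<^esub> + v\<^bsub>i+1\<^esub> = a\<^sub>i v\<^sub>i\<close> for integers \<open>a\<^sub>i\<close>, and the symmetries of the fan are those of the cyclic
  sequence \<open>a\<close>. The sequences of the fans below are \<open>(2,1,2,1,0,0)\<close>, \<open>(4,1,2,2,3,1,2)\<^sup>2\<close>,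
  \<open>(3,1,2,2)\<^sup>3\<close>, \<open>(3,1,2)\<^sup>4\<close>, \<open>(4,1,2)\<^sup>6\<close>, \<open>(1,1,1,0,0)\<close>, \<open>(3,1,2,2,1)\<^sup>2\<close>, \<open>(2,1,2)\<^sup>3\<close>,
  \<open>(0)\<^sup>4\<close> and \<open>(1)\<^sup>6\<close>.
\<close>
lemma planar_group_types_subset: "planar_group_types \<subseteq> range (\<lambda>ps. symmetry_type (fold blow_up ps square))"
  (is "_ \<subseteq> ?R")
proof -
  have "Cyclic 1 \<in> ?R"
    by (rule range_eqI[where x = "[((1, 0), (0, 1)), ((1, 0), (1, 1))]"])
      code_simp
  \<comment> \<open>The first two blow-ups give the hexagon. The others subdivide two opposite cones
    in the same asymmetric way, so that only the central symmetry survives.\<close>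
  moreover have "Cyclic 2 \<in> ?R"
    by (rule range_eqI[where x = "[((1, 0), (0, 1)), ((-1, 0), (0, -1)),
      ((1, 0), (1, 1)), ((1, 0), (2, 1)), ((1, 0), (3, 1)), ((1, 1), (0, 1)),
      ((-1, 0), (-1, -1)), ((-1, 0), (-2, -1)), ((-1, 0), (-3, -1)), ((-1, -1), (0, -1))]"])
      code_simp
  \<comment> \<open>This is the fan of the projective plane, with rays (1,0), (0,1), (-1,-1), each
    cone \<open>(u, w)\<close> being subdivided at u + w, 2u + w and 3u + w. Some of these rays
    already belong to the square.\<close>
  moreover have "Cyclic 3 \<in> ?R"
    by (rule range_eqI[where x = "[((1, 0), (0, 1)), ((1, 0), (1, 1)), ((1, 0), (2, 1)), ((0, 1), (-1, 0)),
      ((0, 1), (-1, 1)), ((-1, 0), (0, -1)), ((-1, -1), (0, -1)), ((-1, -1), (-1, -2))]"])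
      code_simp
  moreover have "Cyclic 4 \<in> ?R"
    by (rule range_eqI[where x = "[((1, 0), (0, 1)), ((1, 0), (1, 1)), ((0, 1), (-1, 0)), ((0, 1), (-1, 1)),
      ((-1, 0), (0, -1)), ((-1, 0), (-1, -1)), ((0, -1), (1, 0)), ((0, -1), (1, -1))]"])
      code_simp
  \<comment> \<open>The lines of the list produce the hexagon, bisect its six cones, and subdivide
    the first half of each, which destroys the reflections.\<close>
  moreover have "Cyclic 6 \<in> ?R"
    by (rule range_eqI[where x = "[((1, 0), (0, 1)), ((-1, 0), (0, -1)),
      ((1, 0), (1, 1)), ((1, 1), (0, 1)), ((0, 1), (-1, 0)), ((-1, 0), (-1, -1)), ((-1, -1), (0, -1)), ((0, -1), (1, 0)),
      ((1, 0), (2, 1)), ((1, 1), (1, 2)), ((0, 1), (-1, 1)), ((-1, 0), (-2, -1)), ((-1, -1), (-1, -2)), ((0, -1), (1, -1))]"])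
      code_simp
  moreover have "Dihedral 1 \<in> ?R"
    by (rule range_eqI[where x = "[((1, 0), (0, 1))]"])
      code_simp
  moreover have "Dihedral 2 \<in> ?R"
    by (rule range_eqI[where x = "[((1, 0), (0, 1)), ((1, 0), (1, 1)), ((1, 0), (2, 1)),
      ((-1, 0), (0, -1)), ((-1, 0), (-1, -1)), ((-1, 0), (-2, -1))]"])
      code_simp
  \<comment> \<open>Again the projective plane, now subdivided at u + w and 2u + w only. The
    resulting cyclic sequence is symmetric about each entry 1, so reflections remain.\<close>
  moreover have "Dihedral 3 \<in> ?R"
    by (rule range_eqI[where x = "[((1, 0), (0, 1)), ((1, 0), (1, 1)), ((0, 1), (-1, 0)),
      ((-1, 0), (0, -1)), ((-1, -1), (0, -1))]"])
      code_simp
  moreover have "Dihedral 4 \<in> ?R"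
    by (rule range_eqI[where x = "[]"])
      code_simp
  moreover have "Dihedral 6 \<in> ?R"
    by (rule range_eqI[where x = "[((1, 0), (0, 1)), ((-1, 0), (0, -1))]"])
      code_simp
  ultimately show ?thesis
    unfolding planar_group_types_def by simp
qed

lemma planar_types_realized:
  assumes "G \<in> planar_group_types"
  shows "\<exists>(N::(real^2) set) \<Sigma>. full_lattice 2 N \<and> smooth_fan N \<Sigma> \<and> complete_fan N \<Sigma> \<and> fan_aut_has_type N \<Sigma> G"
proof -
  obtain ps where G: "G = symmetry_type (fold blow_up ps square)"
    using assms planar_group_types_subset by blast
  have "fan_edges (fold blow_up ps square)"
    by (rule fan_edges_fold_blow_up[OF fan_edges_square])
  then show ?thesis
    unfolding G using Z2.lattice smooth_complete_edge_fan edge_fan_type by blast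
qed

theorem proposition1p2:
  shows "(\<forall>(N::'v::real_vector set) \<Sigma>.
            full_lattice 2 N \<and> smooth_fan N \<Sigma> \<and> complete_fan N \<Sigma> \<longrightarrow>
            (\<exists>G\<in>planar_group_types. fan_aut_has_type N \<Sigma> G)) \<and>
         (\<forall>G\<in>planar_group_types. \<exists>(N::(real^2) set) \<Sigma>.
            full_lattice 2 N \<and> smooth_fan N \<Sigma> \<and> complete_fan N \<Sigma> \<and>
            fan_aut_has_type N \<Sigma> G)"
  using fan_aut_planar_type planar_types_realized by blast

end
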